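(* Writing $E_a=\mathcal E_{a,13}$, $E_1E_3+E_2E_3-E_1E_5-E_1E_7-E_2E_7-E_5E_7=0$, $E_1E_4-E_1E_5+E_3E_7+E_4E_7-E_5E_7=0$, $E_3E_5-E_1E_7-E_3E_7=0$.
   Context: $q=e^{2\pi i\tau}$. For an odd Dirichlet character $\chi$ mod $13$, $E_{1,\chi}(\tau)=1+\frac{2}{L(0,\chi)}\sum_{n\ge1}\chi(n)\frac{q^n}{1-q^n}$ ($L(0,\chi)$ the value at $0$ of the continued $L$-function). For $a$ coprime to $13$, $\mathcal E_{a,13}=\frac{2}{12}\sum_{\chi\text{ odd mod }13}\chi(a)E_{1,\chi}$ (equivalently $(\gamma_{21}\tau+\gamma_{22})^{-1}\mathcal E_{1,13}(\gamma\tau)$ for $\gamma\in SL(2,\mathbb Z)$, $\gamma_{21}\equiv0$, $\gamma_{22}\equiv a\pmod{13}$). *)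

theory Defs
  imports "HOL-Complex_Analysis.Complex_Analysis"
begin

definition dirichlet_character :: "nat \<Rightarrow> (int \<Rightarrow> complex) \<Rightarrow> bool" where
  "dirichlet_character N chi \<longleftrightarrow>
     (\<forall>m n. chi (m * n) = chi m * chi n) \<and>
     (\<forall>n. chi (n + int N) = chi n) \<and>
     (\<forall>n. chi n \<noteq> 0 \<longleftrightarrow> coprime n (int N))"

definition odd_dirichlet_characters :: "nat \<Rightarrow> (int \<Rightarrow> complex) set" where
  "odd_dirichlet_characters N = {chi. dirichlet_character N chi \<and> chi (-1) = -1}"

text \<open>
  The \<open>L\<close>-function is the analytic continuation to \<open>\<complex> - {1}\<close> of the Dirichlet series
  \<open>\<Sum>n\<ge>1. chi(n) n\<^sup>-\<^sup>s\<close>, which converges for \<open>Re s > 1\<close>. The point \<open>1\<close> is removed so that the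
  definition also covers the principal character; the value returned at \<open>1\<close> itself is
  unspecified. Since \<open>\<complex> - {1}\<close> is connected, the value at every other point is unique.
\<close>

definition L_continuation :: "(int \<Rightarrow> complex) \<Rightarrow> (complex \<Rightarrow> complex) \<Rightarrow> bool" where
  "L_continuation chi f \<longleftrightarrow>
     f holomorphic_on (- {1}) \<and>
     (\<forall>s. Re s > 1 \<longrightarrow> (\<lambda>n. chi (int (Suc n)) / of_nat (Suc n) powr s) sums f s)"

definition dirichlet_L :: "(int \<Rightarrow> complex) \<Rightarrow> complex \<Rightarrow> complex" where
  "dirichlet_L chi = (SOME f. L_continuation chi f)"

definition nome :: "complex \<Rightarrow> complex" where
  "nome \<tau> = exp (2 * of_real pi * \<i> * \<tau>)"

definition E1_char :: "(int \<Rightarrow> complex) \<Rightarrow> complex \<Rightarrow> complex" where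
  "E1_char chi \<tau> =
     1 + 2 / dirichlet_L chi 0 *
       (\<Sum>n. chi (int (Suc n)) * (nome \<tau> ^ Suc n / (1 - nome \<tau> ^ Suc n)))"

text \<open>The factor \<open>12\<close> is the number of units modulo \<open>13\<close>.\<close>

definition E13 :: "int \<Rightarrow> complex \<Rightarrow> complex" where
  "E13 a \<tau> = 2 / 12 * (\<Sum>chi \<in> odd_dirichlet_characters 13. chi a * E1_char chi \<tau>)"

end

(*
  Let Q = q^13 and f(x) = 1/2 + sum_{n <> 0} x^n / (1 - Q^n), a normalised Weierstrass zeta function
  in multiplicative notation, and put s(i) = f(q^i) - i/13, which is odd and 13-periodic in i.
  Comparing coefficients of double Laurent series gives
  (s(i) + s(j) + s(k))^2 = P(i) + P(j) + P(k) - 1/2 whenever i + j + k = 13, with P even.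
  Sorting the Lambert series of E_{1,chi} by residues and using L(0,chi) = sum_i chi(i) (1/2 - i/13)
  shows L(0,chi) E_{1,chi} = sum_i chi(i) s(i). An odd character is determined by w = chi(2), where
  w^6 = -1, and inverting L(0,chi) in Q[w]/(w^6 + 1) turns each E_a into a signed sum of four of the
  s(i). Each of the three identities is then half a signed sum of six of the addition formulas, in
  which all the P(i) cancel.
*)
theory Submission
  imports Defs
begin

text \<open>The value L(0,chi) enters through a \<open>SOME\<close>, so a continuation has to be
  constructed and shown unique before any formula for it can be used; repeated Abel summation
  provides it. Everything about f stays in the annulus |Q| < |x| < 1, where the two-sided series
  converges absolutely. The map x -> Q/x preserves this annulus and stands in for quasi-periodicity:
  it gives f(Q/x) = 1 - f(x), and i/13 is the linear correction that turns this into s(13 - i) = -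
  s(i). The same i/13 occurs in L(0,chi), so no constant is left over in L(0,chi) E_{1,chi}. The
  addition formula is the multiplicative form of (zeta(u) + zeta(v) + zeta(w))^2 = wp(u) + wp(v) +
  wp(w) for u + v + w = 0. Each instance contains exactly three P's, so in a combination where all
  P's cancel the coefficients sum to 0 and the constants 1/2 disappear too. The inverse of L(0,chi)
  is (1 - w^2 + w^3 - w^4) / 2: four monomials with coefficients +-1, hence four s(i) in each
  E_a.\<close>

subsection \<open>Values of L-series at zero\<close>

text \<open>This is the sum of (-1)^j binom(m, j) (z + j)^(-s) over j <= m. Each difference gains
  one power of decay in z, which moves the line of convergence one unit to the left.\<close>

primrec powr_diff :: "nat \<Rightarrow> complex \<Rightarrow> complex \<Rightarrow> complex" where
  "powr_diff 0 s z = z powr (-s)"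
| "powr_diff (Suc m) s z = powr_diff m s z - powr_diff m s (z + 1)"

lemma powr_diff_has_field_derivative:
  assumes "Re z > 0"
  shows "(powr_diff m s has_field_derivative - s * powr_diff m (s + 1) z) (at z)"
  using assms
proof (induction m arbitrary: z)
  case 0
  then have "z \<notin> \<real>\<^sub>\<le>\<^sub>0"
    by (auto simp: complex_nonpos_Reals_iff)
  then have "((\<lambda>z. z powr (-s)) has_field_derivative - s * z powr (- s - 1)) (at z)"
    by (rule has_field_derivative_powr)
  moreover have "powr_diff 0 s = (\<lambda>z. z powr (-s))"
    by auto
  moreover have "- s - 1 = - (s + 1)"
    by simp
  ultimately show ?case
    by (simp only: powr_diff.simps)
next
  case (Suc m)
  have "(powr_diff m s has_field_derivative - s * powr_diff m (s + 1) (z + 1)) (at (z + 1))"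
    using Suc.prems by (intro Suc.IH) simp
  then have "((\<lambda>z. powr_diff m s (z + 1)) has_field_derivative - s * powr_diff m (s + 1) (z + 1)) (at z)"
    by (simp add: DERIV_shift)
  from DERIV_diff[OF Suc.IH[OF Suc.prems] this] show ?case
    by (simp add: algebra_simps)
qed

text \<open>Mean value inequality on the segment from x to x + 1. The derivative is again a
  difference of order m, but at s + 1, so the induction runs over all s and the factors s, s + 1,
  ... build up the Pochhammer symbol.\<close>

lemma norm_powr_diff_le:
  assumes "x > 0" "Re s + real m \<ge> 0"
  shows "norm (powr_diff m s (of_real x)) \<le> norm (pochhammer s m) * x powr (- Re s - real m)"
  using assms
proof (induction m arbitrary: s x)
  case 0
  then show ?case
    by (simp add: norm_powr_real_powr)
next
  case (Suc m)
  define S where "S = (of_real ` {x..x+1} :: complex set)"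
  have S: "convex S"
    unfolding S_def by (intro convex_linear_image) (auto simp: bounded_linear.linear bounded_linear_of_real)
  let ?B = "norm s * (norm (pochhammer (s + 1) m) * x powr (- Re s - real (Suc m)))"
  have "norm (powr_diff m s (of_real x) - powr_diff m s (of_real (x + 1)))
      \<le> ?B * norm (complex_of_real x - of_real (x + 1))"
  proof (rule field_differentiable_bound[OF S])
    fix z assume "z \<in> S"
    then obtain y where y: "z = of_real y" "x \<le> y" "y \<le> x + 1"
      by (auto simp: S_def)
    show "(powr_diff m s has_field_derivative - s * powr_diff m (s + 1) z) (at z within S)"
      using y Suc.prems
      by (intro has_field_derivative_at_within[OF powr_diff_has_field_derivative]) simp
    have "norm (powr_diff m (s + 1) (of_real y)) \<le> norm (pochhammer (s + 1) m) * y powr (- Re (s + 1) - real m)"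
      using Suc.prems y by (intro Suc.IH) auto
    \<comment> \<open>The hypothesis on \<open>Re s\<close> makes the exponent nonpositive, so the
      bound is largest at the left end x of the segment.\<close>
    also have "\<dots> \<le> norm (pochhammer (s + 1) m) * x powr (- Re (s + 1) - real m)"
      using Suc.prems y by (intro mult_left_mono powr_mono2') auto
    also have "- Re (s + 1) - real m = - Re s - real (Suc m)"
      by simp
    finally show "norm (- s * powr_diff m (s + 1) z) \<le> ?B"
      unfolding norm_mult norm_minus_cancel
      using y by (intro mult_left_mono) simp_all
  qed (unfold S_def, intro imageI, simp, intro imageI, simp)
  then show ?case
    by (simp add: pochhammer_rec norm_mult algebra_simps)
qed

lemma holomorphic_powr_diff:
  assumes "Re z > 0"
  shows "(\<lambda>s. powr_diff m s z) holomorphic_on A"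
  using assms
proof (induction m arbitrary: z)
  case 0
  then have "z \<noteq> 0" by auto
  then show ?case by (auto intro!: holomorphic_intros)
next
  case (Suc m)
  show ?case
    using Suc.IH[of z] Suc.IH[of "z + 1"] Suc.prems by (auto intro!: holomorphic_intros)
qed

text \<open>At s = 0 the function being differenced is the constant 1; this is what reduces L(0,chi)
  to a finite sum.\<close>

lemma powr_diff_0: "Re z > 0 \<Longrightarrow> powr_diff m 0 z = (if m = 0 then 1 else 0)"
  by (induction m arbitrary: z) (auto simp: complex_eq_iff)

section \<open>Iterated summation by parts for periodic sequences of mean zero\<close>

text \<open>An antidifference of \<open>c\<close>, shifted by a constant so that its own mean over a
  period is 0. Sequences of mean zero are thus closed under it and summation by parts can be
  repeated; compare the passage from one periodic Bernoulli function to the next.\<close>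

definition mean_free_sum :: "nat \<Rightarrow> (nat \<Rightarrow> complex) \<Rightarrow> nat \<Rightarrow> complex" where
  "mean_free_sum N c n = (\<Sum>k<n. c k) - (\<Sum>j<N. \<Sum>k<j. c k) / of_nat N"

definition mean_free_periodic :: "nat \<Rightarrow> (nat \<Rightarrow> complex) \<Rightarrow> bool" where
  "mean_free_periodic N c \<longleftrightarrow> N > 0 \<and> (\<forall>n. c (n + N) = c n) \<and> (\<Sum>k<N. c k) = 0"

lemma mean_free_periodic_bounded:
  assumes "mean_free_periodic N c"
  obtains B where "\<And>n. norm (c n) \<le> B"
proof -
  have mod: "c n = c (n mod N)" for n
  proof -
    have "c (r + N * k) = c r" for r k
    proof (induction k)
      case (Suc k)
      have "c (r + N * Suc k) = c ((r + N * k) + N)" by (simp add: algebra_simps)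
      then show ?case using assms Suc by (simp add: mean_free_periodic_def)
    qed simp
    from this[of "n mod N" "n div N"] show ?thesis by simp
  qed
  show ?thesis
  proof
    fix n
    have "norm (c (n mod N)) \<le> (\<Sum>k<N. norm (c k))"
      using assms by (intro member_le_sum) (auto simp: mean_free_periodic_def)
    then show "norm (c n) \<le> (\<Sum>k<N. norm (c k))"
      using mod[of n] by simp
  qed
qed

lemma mean_free_sum_periodic:
  assumes "mean_free_periodic N c"
  shows "mean_free_sum N c (n + N) = mean_free_sum N c n"
proof -
  have "(\<Sum>k<n + N. c k) = (\<Sum>k<n. c k)"
  proof (induction n)
    case 0
    then show ?case using assms by (simp add: mean_free_periodic_def)
  next
    case (Suc n)
    then show ?case using assms by (simp add: mean_free_periodic_def)
  qed
  then show ?thesis by (simp add: mean_free_sum_def)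
qed

lemma mean_free_periodic_Suc_mean_free_sum:
  assumes "mean_free_periodic N c"
  shows "mean_free_periodic N (\<lambda>n. mean_free_sum N c (Suc n))"
proof -
  have N: "N > 0" using assms by (simp add: mean_free_periodic_def)
  have 0: "(\<Sum>k<N. mean_free_sum N c k) = 0"
    using N by (simp add: mean_free_sum_def sum_subtractf)
  have "(\<Sum>k<N. mean_free_sum N c (Suc k)) = (\<Sum>k<Suc N. mean_free_sum N c k) - mean_free_sum N c 0"
    by (simp only: sum.lessThan_Suc_shift) simp
  also have "\<dots> = 0"
    using 0 mean_free_sum_periodic[OF assms, of 0] by simp
  finally show ?thesis
    using mean_free_sum_periodic[OF assms, of "Suc _"] N
    by (simp add: mean_free_periodic_def)
qed

text \<open>\<open>c\<close> is the difference of the bounded sequence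
  \<open>mean_free_sum N c\<close>, so the boundary term at infinity tends to 0 with
  \<open>h\<close> and only the one at 0 survives.\<close>

lemma summation_by_parts_mean_free:
  fixes h :: "nat \<Rightarrow> complex"
  assumes c: "mean_free_periodic N c" and h: "h \<longlonglongrightarrow> 0"
    and S: "summable (\<lambda>n. mean_free_sum N c (Suc n) * (h n - h (Suc n)))"
  shows "(\<lambda>n. c n * h n) sums
    ((\<Sum>n. mean_free_sum N c (Suc n) * (h n - h (Suc n))) - mean_free_sum N c 0 * h 0)"
proof -
  let ?A = "mean_free_sum N c"
  have parts: "(\<Sum>n<M. c n * h n) =
      (\<Sum>n<M. ?A (Suc n) * (h n - h (Suc n))) - ?A 0 * h 0 + ?A M * h M" for M
  proof (induction M)
    case (Suc M)
    have c_M: "c M = ?A (Suc M) - ?A M" by (simp add: mean_free_sum_def)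
    show ?case unfolding sum.lessThan_Suc Suc.IH c_M by (simp add: algebra_simps)
  qed simp
  obtain B where B: "\<And>n. norm (?A (Suc n)) \<le> B"
    using mean_free_periodic_bounded[OF mean_free_periodic_Suc_mean_free_sum[OF c]] by metis
  have "(\<lambda>n. ?A (Suc n) * h (Suc n)) \<longlonglongrightarrow> 0"
  proof (rule Lim_null_comparison)
    show "\<forall>\<^sub>F n in sequentially. norm (?A (Suc n) * h (Suc n)) \<le> B * norm (h (Suc n))"
      by (intro always_eventually) (auto simp: norm_mult intro!: mult_right_mono B)
    show "(\<lambda>n. B * norm (h (Suc n))) \<longlonglongrightarrow> 0"
      using h by (intro tendsto_mult_right_zero tendsto_norm_zero) (simp add: filterlim_sequentially_Suc)
  qed
  then have "(\<lambda>M. ?A M * h M) \<longlonglongrightarrow> 0"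
    by (simp add: filterlim_sequentially_Suc[of "\<lambda>M. ?A M * h M"])
  moreover have "(\<lambda>M. \<Sum>n<M. ?A (Suc n) * (h n - h (Suc n))) \<longlonglongrightarrow> (\<Sum>n. ?A (Suc n) * (h n - h (Suc n)))"
    using S by (rule summable_LIMSEQ)
  ultimately have "(\<lambda>M. (\<Sum>n<M. ?A (Suc n) * (h n - h (Suc n))) - ?A 0 * h 0 + ?A M * h M)
      \<longlonglongrightarrow> (\<Sum>n. ?A (Suc n) * (h n - h (Suc n))) - ?A 0 * h 0 + 0"
    by (intro tendsto_intros)
  then show ?thesis
    by (simp add: sums_def parts)
qed

primrec iterated_mean_free_sum :: "nat \<Rightarrow> (nat \<Rightarrow> complex) \<Rightarrow> nat \<Rightarrow> nat \<Rightarrow> complex" where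
  "iterated_mean_free_sum N c 0 = c"
| "iterated_mean_free_sum N c (Suc m) = (\<lambda>n. mean_free_sum N (iterated_mean_free_sum N c m) (Suc n))"

lemma mean_free_periodic_iterated:
  "mean_free_periodic N c \<Longrightarrow> mean_free_periodic N (iterated_mean_free_sum N c m)"
  by (induction m) (auto intro: mean_free_periodic_Suc_mean_free_sum)

text \<open>The Dirichlet series \<open>\<Sum> c n (n + 1)\<^sup>-\<^sup>s\<close> after \<open>m\<close> summations by parts; it converges for
  \<open>Re s > 1 - m\<close>.\<close>

definition L_partial :: "nat \<Rightarrow> (nat \<Rightarrow> complex) \<Rightarrow> nat \<Rightarrow> complex \<Rightarrow> complex" where
  "L_partial N c m s =
     (\<Sum>n. iterated_mean_free_sum N c m n * powr_diff m s (of_nat (Suc n))) -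
     (\<Sum>j<m. mean_free_sum N (iterated_mean_free_sum N c j) 0 * powr_diff j s 1)"

lemma norm_powr_diff_nat_le:
  assumes "Re s + real m \<ge> 0"
  shows "norm (powr_diff m s (of_nat (Suc n))) \<le> norm (pochhammer s m) * real (Suc n) powr (- Re s - real m)"
  using norm_powr_diff_le[of "real (Suc n)" s m] assms by (simp only: of_real_of_nat_eq)

lemma summable_powr_diff:
  assumes "mean_free_periodic N c" "Re s + real m > 1"
  shows "summable (\<lambda>n. c n * powr_diff m s (of_nat (Suc n)))"
proof -
  obtain B where B: "\<And>n. norm (c n) \<le> B"
    using mean_free_periodic_bounded[OF assms(1)] by blast
  have "B \<ge> 0" using B[of 0] norm_ge_zero order_trans by blast
  show ?thesis
  proof (rule summable_comparison_test')
    have "summable (\<lambda>n. real n powr (- Re s - real m))"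
      using assms(2) by (subst summable_real_powr_iff) auto
    then have "summable (\<lambda>n. real (Suc n) powr (- Re s - real m))"
      by (subst summable_Suc_iff)
    then show "summable (\<lambda>n. B * (norm (pochhammer s m) * real (Suc n) powr (- Re s - real m)))"
      by (intro summable_mult)
    fix n
    show "norm (c n * powr_diff m s (of_nat (Suc n))) \<le> B * (norm (pochhammer s m) * real (Suc n) powr (- Re s - real m))"
      unfolding norm_mult
      using B[of n] \<open>B \<ge> 0\<close> norm_powr_diff_nat_le[of s m n] assms(2) by (intro mult_mono) auto
  qed
qed

text \<open>One summation by parts: consecutive values of \<open>powr_diff m\<close> differ by a
  value of \<open>powr_diff (Suc m)\<close>, and the boundary term joins the finite sum.\<close>

lemma L_partial_Suc:
  assumes c: "mean_free_periodic N c" and s: "Re s + real m > 1"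
  shows "L_partial N c (Suc m) s = L_partial N c m s"
proof -
  let ?h = "\<lambda>n. powr_diff m s (of_nat (Suc n))"
  let ?c = "iterated_mean_free_sum N c m"
  have eq: "?h n - ?h (Suc n) = powr_diff (Suc m) s (of_nat (Suc n))" for n
    by (simp add: add.commute)
  have "?h \<longlonglongrightarrow> 0"
  proof (rule Lim_null_comparison)
    show "\<forall>\<^sub>F n in sequentially. norm (?h n) \<le> norm (pochhammer s m) * real (Suc n) powr (- Re s - real m)"
      using s by (intro always_eventually allI norm_powr_diff_nat_le) auto
    have "(\<lambda>n. real n powr (- Re s - real m)) \<longlonglongrightarrow> 0"
      using s by (intro tendsto_neg_powr filterlim_real_sequentially) auto
    then show "(\<lambda>n. norm (pochhammer s m) * real (Suc n) powr (- Re s - real m)) \<longlonglongrightarrow> 0"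
      by (intro tendsto_mult_right_zero)
        (simp only: filterlim_sequentially_Suc[of "\<lambda>n. real n powr (- Re s - real m)"])
  qed
  moreover have "summable (\<lambda>n. mean_free_sum N ?c (Suc n) * (?h n - ?h (Suc n)))"
    unfolding eq
    using summable_powr_diff[OF mean_free_periodic_iterated[OF c, of "Suc m"], of s "Suc m"] s by simp
  ultimately have "(\<lambda>n. ?c n * ?h n) sums
      ((\<Sum>n. mean_free_sum N ?c (Suc n) * (?h n - ?h (Suc n))) - mean_free_sum N ?c 0 * ?h 0)"
    by (intro summation_by_parts_mean_free mean_free_periodic_iterated c)
  then have "(\<Sum>n. ?c n * ?h n) = (\<Sum>n. mean_free_sum N ?c (Suc n) * powr_diff (Suc m) s (of_nat (Suc n)))
      - mean_free_sum N ?c 0 * powr_diff m s 1"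
    unfolding eq by (simp add: sums_iff)
  then show ?thesis
    by (simp add: L_partial_def)
qed

lemma L_partial_eq:
  assumes c: "mean_free_periodic N c" and s: "Re s + real m > 1" and "m \<le> m'"
  shows "L_partial N c m' s = L_partial N c m s"
  using assms(3)
proof (induction m' rule: dec_induct)
  case (step k)
  then show ?case using L_partial_Suc[OF c, of s k] s by simp
qed simp

text \<open>The half-plane stops one unit short of that of convergence, so that on each of its discs
  (n + 1)^(-2) is a majorant up to a constant and the M-test applies without choosing a
  margin.\<close>

lemma L_partial_holomorphic:
  assumes c: "mean_free_periodic N c"
  shows "L_partial N c m holomorphic_on {s. Re s + real m > 2}"
proof -
  let ?c = "iterated_mean_free_sum N c m"
  let ?U = "{s. Re s + real m > 2}"
  obtain B where B: "\<And>n. norm (?c n) \<le> B"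
    using mean_free_periodic_bounded[OF mean_free_periodic_iterated[OF c]] by blast
  have "B \<ge> 0" using B[of 0] norm_ge_zero order_trans by blast
  have "open ?U"
    using open_halfspace_Re_gt[of "2 - real m"] by (simp add: algebra_simps)
  have "(\<lambda>s. \<Sum>n. ?c n * powr_diff m s (of_nat (Suc n))) holomorphic_on ?U"
  proof (rule holomorphic_uniform_sequence[OF \<open>open ?U\<close>])
    fix M show "(\<lambda>s. \<Sum>n<M. ?c n * powr_diff m s (of_nat (Suc n))) holomorphic_on ?U"
      by (intro holomorphic_intros holomorphic_powr_diff) simp
  next
    fix s assume "s \<in> ?U"
    then obtain d where d: "d > 0" "cball s d \<subseteq> ?U"
      using \<open>open ?U\<close> open_contains_cball by blast
    have "compact ((\<lambda>z. norm (pochhammer z m)) ` cball s d)"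
      unfolding pochhammer_prod by (intro compact_continuous_image continuous_intros) auto
    then have "bdd_above ((\<lambda>z. norm (pochhammer z m)) ` cball s d)"
      by (intro bounded_imp_bdd_above compact_imp_bounded)
    then obtain K where K: "\<And>z. z \<in> cball s d \<Longrightarrow> norm (pochhammer z m) \<le> K"
      unfolding bdd_above_def by blast
    have "K \<ge> 0" using K[of s] d(1) norm_ge_zero[of "pochhammer s m"]
      by (meson centre_in_cball less_imp_le order_trans)
    have "uniform_limit (cball s d) (\<lambda>M s. \<Sum>n<M. ?c n * powr_diff m s (of_nat (Suc n)))
        (\<lambda>s. \<Sum>n. ?c n * powr_diff m s (of_nat (Suc n))) sequentially"
    proof (rule Weierstrass_m_test)
      have "summable (\<lambda>n. real n powr (- 2))"
        by (subst summable_real_powr_iff) auto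
      then have "summable (\<lambda>n. real (Suc n) powr (- 2))"
        by (subst summable_Suc_iff)
      then show "summable (\<lambda>n. B * (K * real (Suc n) powr (- 2)))"
        by (intro summable_mult)
      fix n z assume z: "z \<in> cball s d"
      then have Re: "Re z + real m > 2" using d(2) by auto
      have "norm (powr_diff m z (of_nat (Suc n))) \<le> norm (pochhammer z m) * real (Suc n) powr (- Re z - real m)"
        using Re by (intro norm_powr_diff_nat_le) auto
      also have "\<dots> \<le> K * real (Suc n) powr (- 2)"
        using K[OF z] Re \<open>K \<ge> 0\<close> by (intro mult_mono powr_mono) auto
      finally show "norm (?c n * powr_diff m z (of_nat (Suc n))) \<le> B * (K * real (Suc n) powr (- 2))"
        unfolding norm_mult using B[of n] \<open>B \<ge> 0\<close> by (intro mult_mono) auto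
    qed
    then show "\<exists>d>0. cball s d \<subseteq> ?U \<and> uniform_limit (cball s d)
        (\<lambda>M s. \<Sum>n<M. ?c n * powr_diff m s (of_nat (Suc n)))
        (\<lambda>s. \<Sum>n. ?c n * powr_diff m s (of_nat (Suc n))) sequentially"
      using d by blast
  qed
  then show ?thesis
    unfolding L_partial_def by (intro holomorphic_intros holomorphic_powr_diff) auto
qed

section \<open>The continued L-function and its value at 0\<close>

text \<open>The functions \<open>L_partial\<close> agree wherever their series converge, so they
  glue to an entire function when the number of summations by parts grows as \<open>Re s\<close>
  decreases.\<close>

lemma L_continuation_exists:
  fixes chi :: "int \<Rightarrow> complex"
  assumes c: "mean_free_periodic N (\<lambda>n. chi (int (Suc n)))"
  obtains f where "L_continuation chi f" "f 0 = - mean_free_sum N (\<lambda>n. chi (int (Suc n))) 0"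
proof -
  let ?c = "\<lambda>n. chi (int (Suc n))"
  define f where "f s = L_partial N ?c (nat \<lceil>2 - Re s\<rceil> + 1) s" for s
  have f_eq: "f s = L_partial N ?c m s" if "Re s + real m > 1" for s m
  proof -
    have "Re s + real (nat \<lceil>2 - Re s\<rceil> + 1) > 1" by linarith
    with that show ?thesis
      unfolding f_def using L_partial_eq[OF c, of s m "nat \<lceil>2 - Re s\<rceil> + 1"]
        L_partial_eq[OF c, of s "nat \<lceil>2 - Re s\<rceil> + 1" m]
      by (cases "m \<le> nat \<lceil>2 - Re s\<rceil> + 1") auto
  qed
  have hol: "f holomorphic_on UNIV"
  proof -
    have "f field_differentiable (at s)" for s
    proof -
      define m where "m = nat \<lceil>3 - Re s\<rceil>"
      let ?U = "{s. Re s + real m > 2}"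
      have U: "open ?U"
        using open_halfspace_Re_gt[of "2 - real m"] by (simp add: algebra_simps)
      have "f holomorphic_on ?U"
        using L_partial_holomorphic[OF c, of m] by (rule holomorphic_transform) (rule f_eq[symmetric], simp)
      moreover have "s \<in> ?U" unfolding m_def by (simp, linarith)
      ultimately show ?thesis using U holomorphic_on_imp_differentiable_at by blast
    qed
    then show ?thesis by (simp add: holomorphic_on_def)
  qed
  have "(\<lambda>n. chi (int (Suc n)) / of_nat (Suc n) powr s) sums f s" if "Re s > 1" for s
  proof -
    have "f s = L_partial N ?c 0 s" using that by (intro f_eq) auto
    moreover have "summable (\<lambda>n. ?c n * powr_diff 0 s (of_nat (Suc n)))"
      using that c by (intro summable_powr_diff) auto
    ultimately show ?thesis
      by (simp add: L_partial_def sums_iff powr_minus field_simps)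
  qed
  moreover have "f holomorphic_on (- {1})" using hol by (rule holomorphic_on_subset) simp
  moreover have "f 0 = - mean_free_sum N ?c 0"
  proof -
    \<comment> \<open>Two summations are the fewest with 0 + m > 1. At s = 0 the series and the
      boundary term j = 1 contain differences of the constant 1 and vanish, which leaves j =
      0.\<close>
    have "f 0 = L_partial N ?c (Suc 1) 0" by (intro f_eq) auto
    then show ?thesis by (simp add: L_partial_def powr_diff_0 del: powr_diff.simps)
  qed
  ultimately show ?thesis using that unfolding L_continuation_def by blast
qed

text \<open>This makes the value of \<open>dirichlet_L\<close> independent of the choice made by
  \<open>SOME\<close>.\<close>

lemma L_continuation_unique:
  assumes "L_continuation chi f" "L_continuation chi g" "s \<noteq> 1"
  shows "f s = g s"
proof (rule analytic_continuation_open[of "{s. Re s > 1}" "- {1}" f g])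
  show "open {s. Re s > 1}" by (rule open_halfspace_Re_gt)
  have "(2::complex) \<in> {s. Re s > 1}" by simp
  then show "{s. Re s > 1} \<noteq> {}" by blast
  show "connected (- {1::complex})"
    by (intro connected_punctured_universe) simp
  show "f z = g z" if "z \<in> {s. Re s > 1}" for z
    using assms(1,2) that unfolding L_continuation_def by (auto intro: sums_unique2)
qed (use assms in \<open>auto simp: L_continuation_def\<close>)

lemma dirichlet_L_0:
  fixes chi :: "int \<Rightarrow> complex"
  assumes N: "N > 0" and per: "\<And>n. chi (n + int N) = chi n" and mean: "(\<Sum>k=1..N. chi (int k)) = 0"
  shows "dirichlet_L chi 0 = - (\<Sum>k=1..N. of_nat k * chi (int k)) / of_nat N"
proof -
  let ?c = "\<lambda>n. chi (int (Suc n))"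
  have shift: "(\<Sum>k<n. g (Suc k)) = (\<Sum>k=1..n. g k)" for g :: "nat \<Rightarrow> complex" and n
    by (simp add: sum.atLeast1_atMost_eq)
  have c: "mean_free_periodic N ?c"
    unfolding mean_free_periodic_def
  proof (intro conjI allI)
    show "?c (n + N) = ?c n" for n using per[of "int (Suc n)"] by (simp add: algebra_simps)
    show "(\<Sum>k<N. ?c k) = 0" using mean shift[of "\<lambda>k. chi (int k)" N] by simp
  qed (rule N)
  obtain f where f: "L_continuation chi f" "f 0 = - mean_free_sum N ?c 0"
    using L_continuation_exists[OF c] .
  from f(1) have "L_continuation chi (dirichlet_L chi)"
    unfolding dirichlet_L_def by (rule someI[of "L_continuation chi"])
  then have "dirichlet_L chi 0 = f 0"
    by (rule L_continuation_unique[OF _ f(1)]) simp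
  also have "\<dots> = (\<Sum>j<N. \<Sum>k<j. ?c k) / of_nat N"
    using f(2) by (simp add: mean_free_sum_def)
  \<comment> \<open>Counted by columns: \<open>?c k\<close> occurs in the M - (k + 1) inner sums
    with j > k.\<close>
  also have "(\<Sum>j<M. \<Sum>k<j. ?c k) = of_nat M * (\<Sum>k<M. ?c k) - (\<Sum>k<M. of_nat (Suc k) * ?c k)" for M
    by (induction M) (simp_all add: algebra_simps)
  also have "(\<Sum>k<N. ?c k) = 0" using c by (simp add: mean_free_periodic_def)
  finally show ?thesis
    using shift[of "\<lambda>k. of_nat k * chi (int k)" N] by simp
qed


subsection \<open>An addition formula for Lambert series\<close>

lemma has_sum_mult_Times:
  fixes f :: "'a \<Rightarrow> complex" and g :: "'b \<Rightarrow> complex"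
  assumes "(\<lambda>x. norm (f x)) summable_on A" "(\<lambda>y. norm (g y)) summable_on B"
    and "(f has_sum s) A" "(g has_sum t) B"
  shows "((\<lambda>(x, y). f x * g y) has_sum (s * t)) (A \<times> B)"
proof (rule has_sum_SigmaI)
  have "(\<lambda>z. norm (case z of (x, y) \<Rightarrow> f x * g y)) summable_on A \<times> B"
  proof (rule summable_on_SigmaI)
    show "((\<lambda>y. norm (case (x, y) of (x, y) \<Rightarrow> f x * g y)) has_sum (norm (f x) * (\<Sum>\<^sub>\<infinity>y\<in>B. norm (g y)))) B" for x
      using has_sum_cmult_right[OF has_sum_infsum[OF assms(2)], of "norm (f x)"]
      by (simp add: norm_mult)
    show "(\<lambda>x. norm (f x) * (\<Sum>\<^sub>\<infinity>y\<in>B. norm (g y))) summable_on A"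
      by (intro summable_on_cmult_left assms)
  qed auto
  then show "(\<lambda>(x, y). f x * g y) summable_on A \<times> B"
    by (rule abs_summable_summable)
  show "((\<lambda>y. case (x, y) of (x, y) \<Rightarrow> f x * g y) has_sum (f x * t)) B" for x
    using has_sum_cmult_right[OF assms(4), of "f x"] by simp
  show "((\<lambda>x. f x * t) has_sum s * t) A"
    using has_sum_cmult_left[OF assms(3), of t] by simp
qed

lemma has_sum_int:
  fixes g :: "int \<Rightarrow> 'a :: {topological_comm_monoid_add, t3_space}"
  assumes "((\<lambda>n. g (int (Suc n))) has_sum s) UNIV" "((\<lambda>n. g (- int (Suc n))) has_sum t) UNIV"
  shows "(g has_sum (g 0 + s + t)) UNIV"
proof -
  have "(g has_sum s) (range (\<lambda>n. int (Suc n)))"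
    using assms(1) by (subst has_sum_reindex) (auto simp: inj_on_def o_def)
  moreover have "(g has_sum t) (range (\<lambda>n. - int (Suc n)))"
    using assms(2) by (subst has_sum_reindex) (auto simp: inj_on_def o_def)
  moreover have "(g has_sum (g 0)) {0}"
    using has_sum_finite[of "{0}" g] by simp
  ultimately have "(g has_sum (g 0 + s + t)) ({0} \<union> range (\<lambda>n. int (Suc n)) \<union> range (\<lambda>n. - int (Suc n)))"
    by (intro has_sum_Un_disjoint) auto
  moreover have "{0} \<union> range (\<lambda>n. int (Suc n)) \<union> range (\<lambda>n. - int (Suc n)) = UNIV"
  proof (intro equalityI subsetI UNIV_I)
    fix k :: int
    consider "k = 0" | "k = int (Suc (nat (k - 1)))" | "k = - int (Suc (nat (- k - 1)))"
      by linarith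
    then show "k \<in> {0} \<union> range (\<lambda>n. int (Suc n)) \<union> range (\<lambda>n. - int (Suc n))"
      by cases (auto simp del: of_nat_Suc)
  qed
  ultimately show ?thesis by simp
qed

lemma summable_on_int:
  fixes g :: "int \<Rightarrow> real"
  assumes "(\<lambda>n. g (int (Suc n))) summable_on UNIV" "(\<lambda>n. g (- int (Suc n))) summable_on UNIV"
  shows "g summable_on UNIV"
  using has_sum_int[OF has_sum_infsum[OF assms(1)] has_sum_infsum[OF assms(2)]]
  by (rule has_sum_imp_summable)

text \<open>The value at 0 makes \<open>c (- n) = 1 - c n\<close> hold for every \<open>n\<close>.\<close>

definition zeta_coeff :: "complex \<Rightarrow> int \<Rightarrow> complex" where
  "zeta_coeff Q n = (if n = 0 then 1 / 2 else 1 / (1 - Q powi n))"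

definition zeta_series :: "complex \<Rightarrow> complex \<Rightarrow> complex" where
  "zeta_series Q x = (\<Sum>\<^sub>\<infinity>n. zeta_coeff Q n * x powi n)"

text \<open>For n nonzero this is Q^n / (1 - Q^n)^2, that is, minus the product of
  \<open>zeta_coeff\<close> at n and at -n.\<close>

definition wp_coeff :: "complex \<Rightarrow> int \<Rightarrow> complex" where
  "wp_coeff Q n = (if n = 0 then 0 else (zeta_coeff Q n)\<^sup>2 - zeta_coeff Q n)"

definition wp_series :: "complex \<Rightarrow> complex \<Rightarrow> complex" where
  "wp_series Q x = (\<Sum>\<^sub>\<infinity>n. wp_coeff Q n * x powi n)"

definition lambert :: "complex \<Rightarrow> complex \<Rightarrow> complex" where
  "lambert Q x = (\<Sum>m. x ^ Suc m / (1 - Q ^ Suc m))"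

lemma power_int_neq_1:
  fixes Q :: complex
  assumes "Q \<noteq> 0" "norm Q < 1" "n \<noteq> 0"
  shows "Q powi n \<noteq> 1"
proof
  assume "Q powi n = 1"
  then have "norm Q powi n = 1" by (metis norm_one norm_power_int)
  moreover have "norm Q powi \<bar>n\<bar> = norm Q powi n \<or> norm Q powi \<bar>n\<bar> = inverse (norm Q powi n)"
    by (cases "n \<ge> 0") (auto simp: power_int_minus)
  ultimately have "norm Q ^ nat \<bar>n\<bar> = 1"
    by (auto simp: power_int_def)
  moreover have "norm Q ^ nat \<bar>n\<bar> < 1"
    using assms by (intro power_Suc_less_one[of "norm Q" "nat \<bar>n\<bar> - 1", simplified] power_less_one_iff[THEN iffD2]) auto
  ultimately show False by simp
qed

context
  fixes Q :: complex
  assumes Q: "Q \<noteq> 0" "norm Q < 1"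
begin

lemma zeta_coeff_minus: "zeta_coeff Q (- n) = 1 - zeta_coeff Q n"
proof (cases "n = 0")
  case False
  define v where "v = Q powi n"
  have v: "1 - v \<noteq> 0" "v \<noteq> 0"
    using power_int_neq_1[OF Q False] Q by (auto simp: v_def)
  have "1 - inverse v = - ((1 - v) / v)"
    using v by (simp add: field_simps)
  then have "1 / (1 - inverse v) = 1 - 1 / (1 - v)"
    using v by (simp add: divide_simps) (simp add: algebra_simps)
  then show ?thesis
    using False by (simp add: zeta_coeff_def v_def power_int_minus)
qed (simp add: zeta_coeff_def)

text \<open>Partial fractions: with u = Q^a and v = Q^b it says 1 / ((1 - u) (1 - v)) = (v / (1 - v)
  - u / (1 - u)) / (v - u).\<close>

lemma zeta_coeff_addition:
  assumes "a \<noteq> 0" "b \<noteq> 0" "a \<noteq> b"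
  shows "zeta_coeff Q a * zeta_coeff Q b - zeta_coeff Q (a - b) * zeta_coeff Q b
    - zeta_coeff Q (b - a) * zeta_coeff Q a = 0"
proof -
  define u v where "u = Q powi a" and "v = Q powi b"
  have uv: "u \<noteq> 1" "v \<noteq> 1" "u \<noteq> 0" "v \<noteq> 0"
    using power_int_neq_1[OF Q] assms Q by (auto simp: u_def v_def)
  have diff: "Q powi (a - b) = u / v" "Q powi (b - a) = v / u"
    using Q by (simp_all add: u_def v_def power_int_diff)
  have "u \<noteq> v"
    using power_int_neq_1[OF Q, of "a - b"] diff assms uv by auto
  then have neq: "1 - u \<noteq> 0" "1 - v \<noteq> 0" "v - u \<noteq> 0"
    using uv by auto
  have "zeta_coeff Q a = 1 / (1 - u)" "zeta_coeff Q b = 1 / (1 - v)"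
    using assms by (simp_all add: zeta_coeff_def u_def v_def)
  moreover have "1 - u / v = (v - u) / v"
    using uv by (simp add: field_simps)
  then have ab: "zeta_coeff Q (a - b) = v / (v - u)"
    using assms by (simp add: zeta_coeff_def diff)
  moreover have "zeta_coeff Q (b - a) = - u / (v - u)"
    using zeta_coeff_minus[of "a - b"] ab neq by (simp add: field_simps)
  ultimately show ?thesis
    using neq by (simp only:) (simp add: divide_simps, simp add: algebra_simps)
qed

lemma norm_one_minus_power_ge: "1 - norm Q \<le> norm (1 - Q ^ Suc m)"
proof -
  have "norm (Q ^ Suc m) \<le> norm Q"
    using Q mult_left_mono[OF power_le_one[of "norm Q" m], of "norm Q"]
    by (simp add: norm_mult norm_power)
  moreover have "norm (1::complex) - norm (Q ^ Suc m) \<le> norm (1 - Q ^ Suc m)"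
    by (rule norm_triangle_ineq2)
  ultimately show ?thesis by simp
qed

lemma norm_zeta_coeff_pos: "norm (zeta_coeff Q (int (Suc m))) \<le> 1 / (1 - norm Q)"
proof -
  have "zeta_coeff Q (int (Suc m)) = 1 / (1 - Q ^ Suc m)"
    unfolding zeta_coeff_def power_int_of_nat by simp
  then show ?thesis
    using norm_one_minus_power_ge[of m] Q by (simp add: norm_divide frac_le del: power_Suc)
qed

text \<open>Exhibits the decay at negative indices that makes the negative half of the series
  converge for |x| > |Q|, as a Lambert series in Q/x.\<close>

lemma zeta_coeff_neg: "zeta_coeff Q (- int (Suc m)) = - (zeta_coeff Q (int (Suc m)) * Q ^ Suc m)"
proof -
  have "zeta_coeff Q (int (Suc m)) = 1 / (1 - Q ^ Suc m)" "Q ^ Suc m \<noteq> 1"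
    using power_int_neq_1[OF Q, of "int (Suc m)"] unfolding zeta_coeff_def power_int_of_nat by simp_all
  then show ?thesis
    unfolding zeta_coeff_minus by (simp add: field_simps)
qed

lemma norm_zeta_coeff_le: "norm (zeta_coeff Q n) \<le> 1 / (1 - norm Q)"
proof -
  consider "n = 0" | m where "n = int (Suc m)" | m where "n = - int (Suc m)"
    by (metis int_cases not0_implies_Suc of_nat_0)
  then show ?thesis
  proof cases
    case 1
    then show ?thesis using Q by (simp add: zeta_coeff_def field_simps)
  next
    case 2
    then show ?thesis using norm_zeta_coeff_pos by simp
  next
    case (3 m)
    have "norm (zeta_coeff Q n) = norm (zeta_coeff Q (int (Suc m))) * norm Q ^ Suc m"
      unfolding 3 zeta_coeff_neg by (simp only: norm_minus_cancel norm_mult norm_power)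
    also have "\<dots> \<le> 1 / (1 - norm Q) * 1"
      using norm_zeta_coeff_pos[of m] Q by (intro mult_mono power_le_one) auto
    finally show ?thesis by simp
  qed
qed

lemma summable_norm_lambert:
  assumes "norm x < 1"
  shows "summable (\<lambda>m. norm (x ^ Suc m / (1 - Q ^ Suc m)))"
proof (rule summable_comparison_test')
  show "summable (\<lambda>m. norm x ^ Suc m * (1 / (1 - norm Q)))"
    using assms by (intro summable_mult2) (simp add: summable_Suc_iff summable_geometric del: power_Suc)
  show "norm (norm (x ^ Suc m / (1 - Q ^ Suc m))) \<le> norm x ^ Suc m * (1 / (1 - norm Q))" for m
    using norm_one_minus_power_ge[of m] Q
    by (simp add: norm_divide norm_power frac_le del: power_Suc)
qed

lemma zeta_coeff_pos_mult: "zeta_coeff Q (int (Suc m)) * x powi int (Suc m) = x ^ Suc m / (1 - Q ^ Suc m)"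
  unfolding zeta_coeff_def power_int_of_nat by simp

lemma zeta_coeff_neg_mult:
  "x \<noteq> 0 \<Longrightarrow> zeta_coeff Q (- int (Suc m)) * x powi (- int (Suc m)) = - ((Q / x) ^ Suc m / (1 - Q ^ Suc m))"
  unfolding zeta_coeff_neg power_int_minus power_int_of_nat
  by (simp add: zeta_coeff_def power_int_of_nat power_divide field_simps del: power_Suc of_nat_Suc)

context
  fixes x :: complex
  assumes x: "norm Q < norm x" "norm x < 1"
begin

lemma reflect_bounds: "norm Q < norm (Q / x)" "norm (Q / x) < 1" "x \<noteq> 0"
proof -
  show "x \<noteq> 0" using x norm_ge_zero[of Q] by auto
  then show "norm (Q / x) < 1" using x by (simp add: norm_divide)
  show "norm Q < norm (Q / x)" using x Q \<open>x \<noteq> 0\<close> by (simp add: norm_divide field_simps)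
qed

lemma abs_summable_zeta: "(\<lambda>n. norm (zeta_coeff Q n * x powi n)) summable_on UNIV"
proof (rule summable_on_int)
  show "(\<lambda>n. norm (zeta_coeff Q (int (Suc n)) * x powi int (Suc n))) summable_on UNIV"
    unfolding zeta_coeff_pos_mult using x
    by (intro summable_nonneg_imp_summable_on summable_norm_lambert) auto
  show "(\<lambda>n. norm (zeta_coeff Q (- int (Suc n)) * x powi (- int (Suc n)))) summable_on UNIV"
    unfolding zeta_coeff_neg_mult[OF reflect_bounds(3)] norm_minus_cancel using reflect_bounds
    by (intro summable_nonneg_imp_summable_on summable_norm_lambert) auto
qed

lemma has_sum_zeta: "((\<lambda>n. zeta_coeff Q n * x powi n) has_sum zeta_series Q x) UNIV"
  unfolding zeta_series_def by (rule has_sum_infsum[OF abs_summable_summable[OF abs_summable_zeta]])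

lemma zeta_series_eq_lambert: "zeta_series Q x = 1 / 2 + lambert Q x - lambert Q (Q / x)"
proof -
  have lam: "((\<lambda>m. z ^ Suc m / (1 - Q ^ Suc m)) has_sum lambert Q z) UNIV" if "norm z < 1" for z
    unfolding lambert_def
    using norm_summable_imp_has_sum[OF summable_norm_lambert[OF that]
        summable_sums[OF summable_norm_cancel[OF summable_norm_lambert[OF that]]]] .
  have "((\<lambda>n. zeta_coeff Q n * x powi n) has_sum
      (zeta_coeff Q 0 * x powi 0 + lambert Q x + - lambert Q (Q / x))) UNIV"
  proof (rule has_sum_int)
    show "((\<lambda>n. zeta_coeff Q (int (Suc n)) * x powi int (Suc n)) has_sum lambert Q x) UNIV"
      unfolding zeta_coeff_pos_mult using x by (intro lam)
    show "((\<lambda>n. zeta_coeff Q (- int (Suc n)) * x powi (- int (Suc n))) has_sum - lambert Q (Q / x)) UNIV"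
      unfolding zeta_coeff_neg_mult[OF reflect_bounds(3)] has_sum_uminus minus_minus
      using reflect_bounds by (intro lam)
  qed
  then have "zeta_series Q x = zeta_coeff Q 0 * x powi 0 + lambert Q x + - lambert Q (Q / x)"
    using has_sum_zeta has_sum_unique by blast
  then show ?thesis by (simp add: zeta_coeff_def)
qed

lemma has_sum_wp: "((\<lambda>n. wp_coeff Q n * x powi n) has_sum wp_series Q x) UNIV"
proof -
  have "(\<lambda>n. norm (wp_coeff Q n * x powi n)) summable_on UNIV"
  proof (rule Infinite_Sum.abs_summable_on_comparison_test')
    show "(\<lambda>n. 1 / (1 - norm Q) * norm (zeta_coeff Q n * x powi n)) summable_on UNIV"
      by (intro summable_on_cmult_right abs_summable_zeta)
    fix n
    \<comment> \<open>Off 0 this is an equality; bounding the factor at -n by a constant leaves the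
      zeta series as majorant.\<close>
    have "norm (wp_coeff Q n) \<le> norm (zeta_coeff Q (- n) * zeta_coeff Q n)"
      unfolding zeta_coeff_minus
      by (auto simp: wp_coeff_def power2_eq_square left_diff_distrib norm_minus_commute)
    also have "\<dots> \<le> 1 / (1 - norm Q) * norm (zeta_coeff Q n)"
      unfolding norm_mult by (intro mult_right_mono norm_zeta_coeff_le) auto
    finally show "norm (wp_coeff Q n * x powi n) \<le> 1 / (1 - norm Q) * norm (zeta_coeff Q n * x powi n)"
      unfolding norm_mult mult.assoc[symmetric] by (intro mult_right_mono) auto
  qed
  then show ?thesis
    unfolding wp_series_def by (rule has_sum_infsum[OF abs_summable_summable])
qed

end

text \<open>Reflection interchanges the two Lambert series in \<open>zeta_series_eq_lambert\<close>;
  the 1 is twice its constant 1/2.\<close>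

lemma zeta_series_reflect:
  assumes x: "norm Q < norm x" "norm x < 1"
  shows "zeta_series Q (Q / x) = 1 - zeta_series Q x"
  using zeta_series_eq_lambert[OF x] zeta_series_eq_lambert[OF reflect_bounds(1,2)[OF x]] Q
  by simp

text \<open>Replace n by -n: \<open>wp_coeff\<close> is even, and Q^(-n) times it is
  \<open>wp_coeff\<close> plus \<open>zeta_coeff\<close>. The 1/2 is the term n = 0, present in
  \<open>zeta_series\<close> but not in \<open>wp_series\<close>.\<close>

lemma wp_series_reflect:
  assumes x: "norm Q < norm x" "norm x < 1"
  shows "wp_series Q (Q / x) = wp_series Q x + zeta_series Q x - 1 / 2"
proof -
  note r = reflect_bounds[OF x]
  have "((\<lambda>n. wp_coeff Q (- n) * (Q / x) powi (- n)) has_sum wp_series Q (Q / x)) UNIV"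
    using has_sum_wp[OF r(1,2)]
    by (subst has_sum_reindex_bij_witness[of UNIV uminus uminus UNIV]) auto
  moreover have "wp_coeff Q (- n) * (Q / x) powi (- n) =
      wp_coeff Q n * x powi n + zeta_coeff Q n * x powi n + (if n = 0 then - (1 / 2) else 0)" for n
  proof (cases "n = 0")
    case False
    have neq: "Q powi n \<noteq> 1" "Q powi n \<noteq> 0"
      using power_int_neq_1[OF Q False] Q by auto
    have "wp_coeff Q (- n) = wp_coeff Q n"
      unfolding wp_coeff_def zeta_coeff_minus by (simp add: power2_eq_square algebra_simps)
    moreover have "wp_coeff Q n * inverse (Q powi n) = wp_coeff Q n + zeta_coeff Q n"
      using neq False by (simp add: wp_coeff_def zeta_coeff_def power2_eq_square divide_simps)
    moreover have "(Q / x) powi (- n) = inverse (Q powi n) * x powi n"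
      by (simp add: power_int_minus power_int_divide_distrib field_simps)
    ultimately show ?thesis
      using False by (simp add: distrib_right flip: mult.assoc)
  qed (simp add: wp_coeff_def zeta_coeff_def)
  ultimately have "((\<lambda>n. wp_coeff Q n * x powi n + zeta_coeff Q n * x powi n + (if n = 0 then - (1 / 2) else 0))
      has_sum wp_series Q (Q / x)) UNIV"
    by simp
  moreover have "((\<lambda>n::int. if n = 0 then - (1 / 2) else 0) has_sum (- (1 / 2) :: complex)) UNIV"
    by (rule has_sum_finite_neutralI[of "{0}"]) auto
  then have "((\<lambda>n. wp_coeff Q n * x powi n + zeta_coeff Q n * x powi n + (if n = 0 then - (1 / 2) else 0))
      has_sum (wp_series Q x + zeta_series Q x + - (1 / 2))) UNIV"
    by (intro has_sum_add has_sum_wp has_sum_zeta x)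
  ultimately show ?thesis
    using has_sum_unique by force
qed

text \<open>Both sides are compared coefficientwise as double Laurent series in \<open>x\<close> and \<open>y\<close>: by
  \<open>zeta_coeff_addition\<close> the coefficient of \<open>x\<^sup>a y\<^sup>b\<close> on the left vanishes
  off the three lines \<open>a = 0\<close>, \<open>b = 0\<close> and \<open>a = b\<close>.\<close>

lemma zeta_series_addition:
  assumes x: "norm x < 1" and y: "norm y < 1" and xy: "norm Q < norm (x * y)"
  shows "zeta_series Q x * zeta_series Q y - zeta_series Q x * zeta_series Q (x * y)
      - zeta_series Q y * zeta_series Q (x * y)
    = wp_series Q x + wp_series Q y + wp_series Q (x * y) - 1 / 4"
proof -
  have nz: "x \<noteq> 0" "y \<noteq> 0" using xy norm_ge_zero[of Q] by auto
  have "norm (x * y) \<le> norm x" "norm (x * y) \<le> norm y"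
    using x y by (simp_all add: norm_mult mult_left_le mult_left_le_one_le)
  with x y xy have bx: "norm Q < norm x" "norm x < 1" and by': "norm Q < norm y" "norm y < 1"
    and bxy: "norm Q < norm (x * y)" "norm (x * y) < 1"
    by auto
  let ?c = "zeta_coeff Q" and ?d = "wp_coeff Q"
  let ?m = "\<lambda>a b. x powi a * y powi b"
  have XY: "((\<lambda>(a, b). ?c a * ?c b * ?m a b) has_sum (zeta_series Q x * zeta_series Q y)) UNIV"
    using has_sum_mult_Times[OF abs_summable_zeta[OF bx] abs_summable_zeta[OF by'] has_sum_zeta[OF bx] has_sum_zeta[OF by']]
    by (simp add: mult_ac)
  have "((\<lambda>(a, b). (?c a * x powi a) * (?c b * (x * y) powi b)) has_sum (zeta_series Q x * zeta_series Q (x * y))) UNIV"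
    using has_sum_mult_Times[OF abs_summable_zeta[OF bx] abs_summable_zeta[OF bxy] has_sum_zeta[OF bx] has_sum_zeta[OF bxy]]
    by simp
  \<comment> \<open>x^j (x y)^b = x^(j + b) y^b, so the shear (j, b) -> (j + b, b) brings the
    product to the monomials x^a y^b; likewise for \<open>Y\<close>.\<close>
  then have X: "((\<lambda>(a, b). ?c (a - b) * ?c b * ?m a b) has_sum (zeta_series Q x * zeta_series Q (x * y))) UNIV"
    by (subst has_sum_reindex_bij_witness[of UNIV "\<lambda>(j, b). (j + b, b)" "\<lambda>(a, b). (a - b, b)" UNIV])
      (auto simp: power_int_mult_distrib power_int_diff nz)
  have "((\<lambda>(a, b). (?c a * y powi a) * (?c b * (x * y) powi b)) has_sum (zeta_series Q y * zeta_series Q (x * y))) UNIV"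
    using has_sum_mult_Times[OF abs_summable_zeta[OF by'] abs_summable_zeta[OF bxy] has_sum_zeta[OF by'] has_sum_zeta[OF bxy]]
    by simp
  then have Y: "((\<lambda>(a, b). ?c (b - a) * ?c a * ?m a b) has_sum (zeta_series Q y * zeta_series Q (x * y))) UNIV"
    by (subst has_sum_reindex_bij_witness[of UNIV "\<lambda>(j, b). (b, j + b)" "\<lambda>(a, b). (b - a, a)" UNIV])
      (auto simp: power_int_mult_distrib power_int_diff nz)
  have line: "(G has_sum wp_series Q z) UNIV"
    if "norm Q < norm z" "norm z < 1" "inj h" "\<And>n. G (h n) = ?d n * z powi n" "\<And>p. p \<notin> range h \<Longrightarrow> G p = 0"
    for z and h :: "int \<Rightarrow> int \<times> int" and G
  proof -
    have "(G has_sum wp_series Q z) (range h) \<longleftrightarrow> (G has_sum wp_series Q z) UNIV"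
      using that(5) by (intro has_sum_cong_neutral) auto
    moreover have "(G has_sum wp_series Q z) (range h)"
      using has_sum_wp[OF that(1,2)] that(3,4) by (simp add: has_sum_reindex o_def)
    ultimately show ?thesis by simp
  qed
  have "((\<lambda>(a, b). if b = 0 then ?d a * ?m a b else 0) has_sum wp_series Q x) UNIV"
    by (rule line[OF bx, of "\<lambda>a. (a, 0)"]) (auto simp: inj_on_def)
  moreover have "((\<lambda>(a, b). if a = 0 then ?d b * ?m a b else 0) has_sum wp_series Q y) UNIV"
    by (rule line[OF by', of "\<lambda>b. (0, b)"]) (auto simp: inj_on_def)
  moreover have "((\<lambda>(a, b). if a = b then ?d a * ?m a b else 0) has_sum wp_series Q (x * y)) UNIV"
    by (rule line[OF bxy, of "\<lambda>a. (a, a)"]) (auto simp: inj_on_def power_int_mult_distrib)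
  \<comment> \<open>At the origin the three products give 1/4 - 1/4 - 1/4, while the three lines
    meeting there contribute 0 because \<open>wp_coeff\<close> vanishes at 0.\<close>
  moreover have "((\<lambda>(a, b). if a = (0::int) \<and> b = (0::int) then - (1 / 4) else 0) has_sum (- (1 / 4) :: complex)) UNIV"
    by (rule has_sum_finite_neutralI[of "{(0, 0)}"]) (auto split: if_splits)
  ultimately have "((\<lambda>p. (case p of (a, b) \<Rightarrow> if b = 0 then ?d a * ?m a b else 0)
      + (case p of (a, b) \<Rightarrow> if a = 0 then ?d b * ?m a b else 0)
      + (case p of (a, b) \<Rightarrow> if a = b then ?d a * ?m a b else 0)
      + (case p of (a, b) \<Rightarrow> if a = (0::int) \<and> b = (0::int) then - (1 / 4) else 0))
    has_sum (wp_series Q x + wp_series Q y + wp_series Q (x * y) + - (1 / 4))) UNIV"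
    by (intro has_sum_add)
  moreover have "((\<lambda>p. (case p of (a, b) \<Rightarrow> ?c a * ?c b * ?m a b)
      - (case p of (a, b) \<Rightarrow> ?c (a - b) * ?c b * ?m a b) - (case p of (a, b) \<Rightarrow> ?c (b - a) * ?c a * ?m a b))
    has_sum (zeta_series Q x * zeta_series Q y - zeta_series Q x * zeta_series Q (x * y)
      - zeta_series Q y * zeta_series Q (x * y))) UNIV"
    using has_sum_add[OF has_sum_add[OF XY has_sum_uminusI[OF X]] has_sum_uminusI[OF Y]]
    by (simp only: diff_conv_add_uminus)
  moreover have "?c a * ?c b * ?m a b - ?c (a - b) * ?c b * ?m a b - ?c (b - a) * ?c a * ?m a b
      = (if b = 0 then ?d a * ?m a b else 0) + (if a = 0 then ?d b * ?m a b else 0)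
      + (if a = b then ?d a * ?m a b else 0) + (if a = 0 \<and> b = 0 then - (1 / 4) else 0)" for a b
  proof -
    have c0: "?c 0 = 1 / 2" "?d 0 = 0" by (simp_all add: zeta_coeff_def wp_coeff_def)
    consider "a = 0" "b = 0" | "a = 0" "b \<noteq> 0" | "a \<noteq> 0" "b = 0" | "a = b" "a \<noteq> 0" | "a \<noteq> 0" "b \<noteq> 0" "a \<noteq> b"
      by blast
    then show ?thesis
    proof cases
      case 5
      have "?c a * ?c b * ?m a b - ?c (a - b) * ?c b * ?m a b - ?c (b - a) * ?c a * ?m a b
        = (?c a * ?c b - ?c (a - b) * ?c b - ?c (b - a) * ?c a) * ?m a b"
        by (simp add: left_diff_distrib)
      then show ?thesis using zeta_coeff_addition[OF 5] 5 by simp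
    \<comment> \<open>On the axes the two terms containing \<open>?c 0\<close> cancel and - c(n)
      c(-n) remains; on the diagonal they add up to - c(n).\<close>
    qed (auto simp: c0 zeta_coeff_minus wp_coeff_def power2_eq_square algebra_simps)
  qed
  then have "(\<lambda>p. (case p of (a, b) \<Rightarrow> ?c a * ?c b * ?m a b)
      - (case p of (a, b) \<Rightarrow> ?c (a - b) * ?c b * ?m a b) - (case p of (a, b) \<Rightarrow> ?c (b - a) * ?c a * ?m a b))
    = (\<lambda>p. (case p of (a, b) \<Rightarrow> if b = 0 then ?d a * ?m a b else 0)
      + (case p of (a, b) \<Rightarrow> if a = 0 then ?d b * ?m a b else 0)
      + (case p of (a, b) \<Rightarrow> if a = b then ?d a * ?m a b else 0)
      + (case p of (a, b) \<Rightarrow> if a = (0::int) \<and> b = (0::int) then - (1 / 4) else 0))"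
    by (intro ext) (simp only: case_prod_unfold)
  ultimately show ?thesis
    by (simp add: has_sum_unique)
qed

end


subsection \<open>Lambert series twisted by a periodic function\<close>

text \<open>By periodicity the tail from N on is z^N times the whole series.\<close>

lemma periodic_power_series_sums:
  fixes chi :: "int \<Rightarrow> complex"
  assumes N: "N > 0" and per: "\<And>n. chi (n + int N) = chi n" and z: "norm z < 1"
    and summable: "summable (\<lambda>n. chi (int (Suc n)) * z ^ Suc n)"
  shows "(\<lambda>n. chi (int (Suc n)) * z ^ Suc n) sums ((\<Sum>a=1..N. chi (int a) * z ^ a) / (1 - z ^ N))"
proof -
  let ?f = "\<lambda>n. chi (int (Suc n)) * z ^ Suc n"
  have "(\<lambda>n. ?f (n + N)) = (\<lambda>n. z ^ N * ?f n)"
    using per[of "int (Suc _)"] by (auto simp: power_add algebra_simps)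
  then have "suminf ?f = z ^ N * suminf ?f + sum ?f {..<N}"
    using suminf_split_initial_segment[OF summable, of N] suminf_mult[OF summable, of "z ^ N"]
    by (simp only:)
  moreover have "sum ?f {..<N} = (\<Sum>a=1..N. chi (int a) * z ^ a)"
    by (simp add: sum.atLeast1_atMost_eq)
  ultimately have "suminf ?f * (1 - z ^ N) = (\<Sum>a=1..N. chi (int a) * z ^ a)"
    by (simp add: algebra_simps)
  moreover have "norm (z ^ N) < 1"
    using z N by (simp add: norm_power power_less_one_iff)
  then have "1 - z ^ N \<noteq> 0" by auto
  ultimately have "suminf ?f = (\<Sum>a=1..N. chi (int a) * z ^ a) / (1 - z ^ N)"
    by (simp add: field_simps)
  with summable_sums[OF summable] show ?thesis by simp
qed

text \<open>The double series of chi(n) q^(n m) over n, m >= 1 converges absolutely. Summing over m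
  first gives the left side; summing over n first, by residues modulo N, gives the right
  side.\<close>

lemma periodic_lambert_eq:
  fixes chi :: "int \<Rightarrow> complex"
  assumes N: "N > 0" and per: "\<And>n. chi (n + int N) = chi n" and bound: "\<And>n. norm (chi n) \<le> B"
    and q: "q \<noteq> 0" "norm q < 1"
  shows "(\<Sum>n. chi (int (Suc n)) * (q ^ Suc n / (1 - q ^ Suc n)))
    = (\<Sum>a=1..N. chi (int a) * lambert (q ^ N) (q ^ a))"
proof -
  let ?F = "\<lambda>(n, m). chi (int (Suc n)) * (q ^ Suc n) ^ Suc m"
  have "B \<ge> 0" using bound[of 0] norm_ge_zero order_trans by blast
  have geom: "(\<lambda>m. z ^ Suc m) sums (z / (1 - z))" if "norm z < 1" for z :: "'a :: {real_normed_field, banach}"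
    using sums_mult[OF geometric_sums[OF that], of z] by simp
  have small: "norm (q ^ Suc n) < 1" for n
    using q by (simp add: norm_power power_less_one_iff del: power_Suc)
  have "(\<lambda>p. norm (?F p)) summable_on UNIV \<times> UNIV"
  proof (rule summable_on_SigmaI)
    fix n
    have "norm (norm (q ^ Suc n)) < 1" using small[of n] by simp
    from sums_mult[OF geom[OF this], of "norm (chi (int (Suc n)))"]
    show "((\<lambda>m. norm (?F (n, m))) has_sum
        (norm (chi (int (Suc n))) * (norm (q ^ Suc n) / (1 - norm (q ^ Suc n))))) UNIV"
      by (intro norm_summable_imp_has_sum)
        (simp_all add: norm_mult norm_power sums_iff del: power_Suc)
  next
    have "(\<lambda>n. B * (norm q ^ Suc n * (1 / (1 - norm q)))) summable_on UNIV"
      using q geom[of "norm q"]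
      by (intro summable_nonneg_imp_summable_on summable_mult summable_mult2)
        (auto simp: sums_iff \<open>B \<ge> 0\<close> simp del: power_Suc)
    then show "(\<lambda>n. norm (chi (int (Suc n))) * (norm (q ^ Suc n) / (1 - norm (q ^ Suc n)))) summable_on UNIV"
    proof (rule summable_on_comparison_test)
      fix n
      have "norm q ^ Suc n \<le> norm q"
        using q mult_left_mono[OF power_le_one[of "norm q" n], of "norm q"] by simp
      then have "norm q ^ Suc n / (1 - norm q ^ Suc n) \<le> norm q ^ Suc n * (1 / (1 - norm q))"
        using q by (simp add: frac_le del: power_Suc)
      then show "norm (chi (int (Suc n))) * (norm (q ^ Suc n) / (1 - norm (q ^ Suc n)))
          \<le> B * (norm q ^ Suc n * (1 / (1 - norm q)))"
        unfolding norm_power using small[of n] bound \<open>B \<ge> 0\<close>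
        by (intro mult_mono) (auto simp: norm_power simp del: power_Suc)
      show "0 \<le> norm (chi (int (Suc n))) * (norm (q ^ Suc n) / (1 - norm (q ^ Suc n)))"
        using small[of n] by simp
    qed
  qed auto
  then have F: "(?F has_sum infsum ?F UNIV) (UNIV \<times> UNIV)"
    using abs_summable_summable[of ?F UNIV] by simp
  have "((\<lambda>n. chi (int (Suc n)) * (q ^ Suc n / (1 - q ^ Suc n))) has_sum infsum ?F UNIV) UNIV"
  proof (rule has_sum_SigmaD[OF F])
    fix n
    have "((\<lambda>m. (q ^ Suc n) ^ Suc m) has_sum (q ^ Suc n / (1 - q ^ Suc n))) UNIV"
      using geom[OF small[of n]] geom[of "norm (q ^ Suc n)"] small[of n]
      by (intro norm_summable_imp_has_sum) (simp_all add: norm_power sums_iff del: power_Suc)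
    from has_sum_cmult_right[OF this, of "chi (int (Suc n))"]
    show "((\<lambda>m. ?F (n, m)) has_sum (chi (int (Suc n)) * (q ^ Suc n / (1 - q ^ Suc n)))) UNIV"
      by simp
  qed
  then have 1: "(\<lambda>n. chi (int (Suc n)) * (q ^ Suc n / (1 - q ^ Suc n))) sums infsum ?F UNIV"
    by (rule has_sum_imp_sums)
  have swap: "((\<lambda>(m, n). ?F (n, m)) has_sum infsum ?F UNIV) (UNIV \<times> UNIV)"
    using F by (subst (asm) has_sum_swap)
  have "((\<lambda>m. \<Sum>a=1..N. chi (int a) * ((q ^ a) ^ Suc m / (1 - (q ^ N) ^ Suc m))) has_sum infsum ?F UNIV) UNIV"
  proof (rule has_sum_SigmaD[OF swap])
    fix m
    let ?z = "q ^ Suc m"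
    have "(\<lambda>n. B * norm ?z ^ Suc n) summable_on UNIV"
      using geom[of "norm ?z"] small[of m] \<open>B \<ge> 0\<close>
      by (intro summable_nonneg_imp_summable_on summable_mult) (auto simp: sums_iff simp del: power_Suc)
    then have "(\<lambda>n. norm (chi (int (Suc n)) * ?z ^ Suc n)) summable_on UNIV"
      by (rule Infinite_Sum.abs_summable_on_comparison_test')
        (auto simp: norm_mult norm_power simp del: power_Suc intro!: mult_right_mono bound)
    then have sm: "((\<lambda>n. chi (int (Suc n)) * ?z ^ Suc n) has_sum (\<Sum>\<^sub>\<infinity>n. chi (int (Suc n)) * ?z ^ Suc n)) UNIV"
      by (rule has_sum_infsum[OF abs_summable_summable])
    then have "(\<lambda>n. chi (int (Suc n)) * ?z ^ Suc n) sums (\<Sum>\<^sub>\<infinity>n. chi (int (Suc n)) * ?z ^ Suc n)"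
      by (rule has_sum_imp_sums)
    moreover from this have "(\<lambda>n. chi (int (Suc n)) * ?z ^ Suc n) sums ((\<Sum>a=1..N. chi (int a) * ?z ^ a) / (1 - ?z ^ N))"
      by (intro periodic_power_series_sums N per small) (simp add: sums_iff)
    ultimately have "(\<Sum>\<^sub>\<infinity>n. chi (int (Suc n)) * ?z ^ Suc n) = (\<Sum>a=1..N. chi (int a) * ?z ^ a) / (1 - ?z ^ N)"
      by (rule sums_unique2)
    also have "\<dots> = (\<Sum>a=1..N. chi (int a) * ((q ^ a) ^ Suc m / (1 - (q ^ N) ^ Suc m)))"
      by (simp add: sum_divide_distrib mult.commute flip: power_mult del: power_Suc)
    finally show "((\<lambda>n. case (m, n) of (m, n) \<Rightarrow> ?F (n, m)) has_sum
        (\<Sum>a=1..N. chi (int a) * ((q ^ a) ^ Suc m / (1 - (q ^ N) ^ Suc m)))) UNIV"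
      using sm by (simp add: mult.commute flip: power_mult del: power_Suc)
  qed
  then have 2: "(\<lambda>m. \<Sum>a=1..N. chi (int a) * ((q ^ a) ^ Suc m / (1 - (q ^ N) ^ Suc m))) sums infsum ?F UNIV"
    by (rule has_sum_imp_sums)
  have "(\<lambda>m. \<Sum>a=1..N. chi (int a) * ((q ^ a) ^ Suc m / (1 - (q ^ N) ^ Suc m))) sums
      (\<Sum>a=1..N. chi (int a) * lambert (q ^ N) (q ^ a))"
  proof (intro sums_sum sums_mult)
    fix a assume a: "a \<in> {1..N}"
    have "q ^ N \<noteq> 0" "norm (q ^ N) < 1" "norm (q ^ a) < 1"
      using q a N by (auto simp: norm_power power_less_one_iff)
    then show "(\<lambda>m. (q ^ a) ^ Suc m / (1 - (q ^ N) ^ Suc m)) sums lambert (q ^ N) (q ^ a)"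
      unfolding lambert_def by (intro summable_sums summable_norm_cancel[OF summable_norm_lambert])
  qed
  with 1 2 show ?thesis
    using sums_unique2 by (metis (no_types, lifting) sums_unique)
qed

subsection \<open>The odd characters modulo 13\<close>

text \<open>Discrete logarithm to the base 2, a primitive root modulo 13. The entry at residue 0 is a
  junk value.\<close>

definition dlog13 :: "int \<Rightarrow> nat" where
  "dlog13 n = [0, 0, 1, 4, 2, 9, 5, 11, 3, 8, 10, 7, 6] ! nat (n mod 13)"

definition char13 :: "complex \<Rightarrow> int \<Rightarrow> complex" where
  "char13 w n = (if 13 dvd n then 0 else w ^ dlog13 n)"

lemma dlog13_mod [simp]: "dlog13 (n mod 13) = dlog13 n"
  by (simp add: dlog13_def)

lemma residue13: "\<not> 13 dvd n \<Longrightarrow> n mod 13 \<in> {1..12 :: int}"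
  using pos_mod_bound[of 13 n] pos_mod_sign[of 13 n] by (simp add: dvd_eq_mod_eq_0 del: pos_mod_bound pos_mod_sign)

lemma power_mod_12:
  fixes w :: complex
  assumes "w ^ 6 = -1"
  shows "w ^ n = w ^ (n mod 12)"
proof -
  have "w ^ 12 = 1" using assms power_mult[of w 6 2] by simp
  then have "w ^ (12 * (n div 12) + n mod 12) = w ^ (n mod 12)"
    by (simp only: power_add power_mult power_one mult_1)
  then show ?thesis by simp
qed

lemma power_dlog13:
  assumes "\<not> 13 dvd n"
  shows "2 ^ dlog13 n mod 13 = n mod 13"
proof -
  have "\<forall>x\<in>{1..12::int}. 2 ^ dlog13 x mod 13 = x"
    by code_simp
  from this[rule_format, OF residue13[OF assms]] show ?thesis by simp
qed

lemma dlog13_power: "dlog13 (2 ^ k) = k mod 12"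
proof -
  have "(2 ^ 12) ^ (k div 12) mod 13 = ((2 ^ 12 mod 13) ^ (k div 12) mod 13 :: int)"
    by (rule power_mod[symmetric])
  then have one: "(2 ^ 12) ^ (k div 12) mod 13 = (1 :: int)"
    by simp
  have "(2 :: int) ^ k = (2 ^ 12) ^ (k div 12) * 2 ^ (k mod 12)"
    by (simp only: power_add[symmetric] power_mult[symmetric] mult_div_mod_eq)
  then have "(2 ^ k :: int) mod 13 = ((2 ^ 12) ^ (k div 12) mod 13) * 2 ^ (k mod 12) mod 13"
    by (simp only: mod_mult_left_eq)
  then have "dlog13 (2 ^ k) = dlog13 (2 ^ (k mod 12))"
    unfolding one mult_1 by (simp only: dlog13_def)
  also have "\<forall>i\<in>{0..<12}. dlog13 (2 ^ i) = i"
    by code_simp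
  then have "dlog13 (2 ^ (k mod 12)) = k mod 12"
    by simp
  finally show ?thesis .
qed

text \<open>Both factors are replaced by powers of 2, where \<open>dlog13_power\<close> applies, so
  no table of products is checked.\<close>

lemma dlog13_mult:
  assumes "\<not> 13 dvd m" "\<not> 13 dvd n"
  shows "dlog13 (m * n) = (dlog13 m + dlog13 n) mod 12"
proof -
  have "(m * n) mod 13 = 2 ^ (dlog13 m + dlog13 n) mod 13"
    unfolding power_add mod_mult_eq[of m 13 n, symmetric]
      mod_mult_eq[of "2 ^ dlog13 m" 13 "2 ^ dlog13 n", symmetric]
    by (simp only: power_dlog13[OF assms(1)] power_dlog13[OF assms(2)])
  then show ?thesis
    using dlog13_power[of "dlog13 m + dlog13 n"] by (simp only: dlog13_def)
qed

lemma coprime_13_iff: "coprime n (13 :: int) \<longleftrightarrow> \<not> 13 dvd n"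
proof -
  have "prime (13 :: int)" by simp
  then show ?thesis by (metis coprime_commute not_prime_unit prime_imp_coprime coprime_absorb_left)
qed

lemma char13_odd:
  assumes w: "w ^ 6 = -1"
  shows "char13 w \<in> odd_dirichlet_characters 13"
proof -
  have "w \<noteq> 0" using w by auto
  have "char13 w (m * n) = char13 w m * char13 w n" for m n
  proof (cases "13 dvd m \<or> 13 dvd n")
    case False
    have "prime (13 :: int)" by simp
    then have "\<not> 13 dvd m * n" using False prime_dvd_mult_iff by blast
    then show ?thesis
      using False dlog13_mult[of m n] power_mod_12[OF w, of "dlog13 m + dlog13 n"]
      by (simp add: char13_def power_add)
  qed (auto simp: char13_def)
  moreover have "char13 w (n + int 13) = char13 w n" for n
    by (simp add: char13_def dlog13_def)
  \<comment> \<open>-1 is congruent to 12, whose logarithm is 6; oddness is therefore w^6 =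
    -1.\<close>
  moreover have "char13 w (-1) = -1" using w by (simp add: char13_def dlog13_def)
  ultimately show ?thesis
    using \<open>w \<noteq> 0\<close> by (auto simp: odd_dirichlet_characters_def dirichlet_character_def coprime_13_iff char13_def)
qed

lemma odd_character_13:
  assumes "chi \<in> odd_dirichlet_characters 13"
  shows "(chi 2) ^ 6 = -1" "chi = char13 (chi 2)"
proof -
  have mult: "chi (m * n) = chi m * chi n" and per: "chi (n + 13) = chi n"
    and zero: "chi n \<noteq> 0 \<longleftrightarrow> \<not> 13 dvd n" and odd: "chi (-1) = -1" for m n
    using assms by (auto simp: odd_dirichlet_characters_def dirichlet_character_def coprime_13_iff)
  have "chi (1 * 1) = chi 1 * chi 1" by (rule mult)
  then have one: "chi 1 = 1" using zero[of 1] by simp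
  have pow: "chi (2 ^ k) = chi 2 ^ k" for k
    by (induction k) (simp_all add: one mult)
  have per': "chi (r + 13 * int k) = chi r" for r k
  proof (induction k)
    case (Suc k)
    show ?case using per[of "r + 13 * int k"] Suc by (simp add: algebra_simps)
  qed simp
  have mod: "chi n = chi (n mod 13)" for n
  proof (cases "n \<ge> 0")
    case True
    then show ?thesis using per'[of "n mod 13" "nat (n div 13)"] by (simp add: pos_imp_zdiv_nonneg_iff)
  next
    case False
    then have "n div 13 \<le> 0" using div_nonpos_pos_le0 by fastforce
    then show ?thesis
      using per'[of n "nat (- (n div 13))"] by (simp add: minus_mult_div_eq_mod)
  qed
  \<comment> \<open>64 is congruent to -1 modulo 13.\<close>
  have "chi (2 ^ 6) = chi (- 1)" by (subst (1 2) mod) simp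
  then show "chi 2 ^ 6 = - 1" using pow[of 6] odd by simp
  show "chi = char13 (chi 2)"
  proof
    fix n
    show "chi n = char13 (chi 2) n"
    proof (cases "13 dvd n")
      case True
      then show ?thesis using zero[of n] by (simp add: char13_def)
    next
      case False
      then have "n mod 13 = 2 ^ dlog13 n mod 13"
        by (simp add: power_dlog13)
      then have "chi n = chi (2 ^ dlog13 n)" using mod[of n] mod[of "2 ^ dlog13 n"] by simp
      then show ?thesis using False pow by (simp add: char13_def)
    qed
  qed
qed

lemma bij_betw_char13: "bij_betw char13 {w. w ^ 6 = -1} (odd_dirichlet_characters 13)"
proof (rule bij_betw_byWitness[where f' = "\<lambda>chi. chi 2"])
  show "\<forall>w\<in>{w. w ^ 6 = -1}. char13 w 2 = w" by (simp add: char13_def dlog13_def)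
qed (use odd_character_13 char13_odd in auto)

text \<open>The roots form a coset of the sixth roots of unity. Multiplication by a primitive one,
  \<zeta>, permutes them and scales the sum by \<zeta>^k, which is not 1 unless 6 divides k.\<close>

lemma sum_power_roots:
  "(\<Sum>w | w ^ 6 = (-1 :: complex). w ^ k) = (if 6 dvd k then 6 * (-1) ^ (k div 6) else 0)"
proof (cases "6 dvd k")
  case True
  then obtain j where "k = 6 * j" by blast
  then have "(\<Sum>w | w ^ 6 = (-1 :: complex). w ^ k) = (\<Sum>w | w ^ 6 = (-1 :: complex). (-1) ^ j)"
    by (intro sum.cong) (auto simp: power_mult)
  then show ?thesis using card_nth_roots[of "-1" 6] \<open>k = 6 * j\<close> by simp
next
  case False
  \<comment> \<open>This is exp(i pi / 3); in coordinates \<zeta>^2 = \<zeta> - 1 is immediate, and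
    it reduces every power to degree at most 1.\<close>
  define \<zeta> where "\<zeta> = Complex (1 / 2) (sqrt 3 / 2)"
  have \<zeta>2: "\<zeta> * \<zeta> = \<zeta> - 1"
    by (simp add: \<zeta>_def complex_eq_iff)
  have \<zeta>3: "\<zeta> ^ 3 = -1"
    unfolding power3_eq_cube \<zeta>2 by (simp add: left_diff_distrib \<zeta>2)
  have \<zeta>6: "\<zeta> ^ 6 = 1" using \<zeta>3 power_mult[of \<zeta> 3 2] by simp
  have "\<zeta> ^ k = \<zeta> ^ (k mod 6)"
  proof -
    have "\<zeta> ^ (6 * (k div 6) + k mod 6) = \<zeta> ^ (k mod 6)"
      by (simp only: power_add power_mult \<zeta>6 power_one mult_1)
    then show ?thesis by simp
  qed
  moreover have "k mod 6 \<in> {1, 2, 3, 4, 5}" using False by (auto simp: dvd_eq_mod_eq_0)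
  moreover have "\<zeta> ^ 2 = \<zeta> - 1" "\<zeta> ^ 4 = - \<zeta>" "\<zeta> ^ 5 = 1 - \<zeta>"
    using \<zeta>2 \<zeta>3 power_add[of \<zeta> 3 1] power_add[of \<zeta> 3 2] by (simp_all add: power2_eq_square)
  ultimately have neq: "\<zeta> ^ k \<noteq> 1"
    using \<zeta>3 by (auto simp: \<zeta>_def complex_eq_iff)
  have "(\<Sum>w | w ^ 6 = (-1 :: complex). w ^ k) = (\<Sum>w | w ^ 6 = (-1 :: complex). (\<zeta> * w) ^ k)"
    by (rule sum.reindex_bij_witness[of _ "\<lambda>w. \<zeta> * w" "\<lambda>w. w / \<zeta>"])
      (use \<zeta>6 in \<open>auto simp: power_mult_distrib power_divide\<close>)
  also have "\<dots> = \<zeta> ^ k * (\<Sum>w | w ^ 6 = (-1 :: complex). w ^ k)"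
    by (simp add: power_mult_distrib sum_distrib_left)
  finally show ?thesis using neq False by simp
qed

subsection \<open>The Eisenstein series of level 13\<close>

definition zeta13 :: "complex \<Rightarrow> nat \<Rightarrow> complex" where
  "zeta13 q i = zeta_series (q ^ 13) (q ^ i) - of_nat i / 13"

text \<open>Plays the part of the Weierstrass wp-function. \<open>wp_series\<close> alone is not
  invariant under reflection; adding the square repairs this, since 2 (f - 1/2) + (1 - f)^2 = f^2.
  The same squares appear when the square in the addition formula is expanded.\<close>

definition wp13 :: "complex \<Rightarrow> nat \<Rightarrow> complex" where
  "wp13 q i = 2 * wp_series (q ^ 13) (q ^ i) + (zeta_series (q ^ 13) (q ^ i))\<^sup>2"

context
  fixes q :: complex
  assumes q: "q \<noteq> 0" "norm q < 1"
begin

lemma power13_bounds: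
  "q ^ 13 \<noteq> 0" "norm (q ^ 13) < 1"
  "i > 0 \<Longrightarrow> norm (q ^ i) < 1" "i < 13 \<Longrightarrow> norm (q ^ 13) < norm (q ^ i)"
  using q by (auto simp: norm_power power_less_one_iff intro: power_strict_decreasing)

lemma reflect13: "i < 13 \<Longrightarrow> q ^ 13 / q ^ i = q ^ (13 - i)"
  using q by (simp add: power_diff)

lemma zeta13_reflect:
  assumes "0 < i" "i < 13"
  shows "zeta13 q (13 - i) = - zeta13 q i"
  using zeta_series_reflect[OF power13_bounds(1,2), of "q ^ i"] power13_bounds(3,4)[of i] reflect13[of i] assms
  by (simp add: zeta13_def of_nat_diff diff_divide_distrib)

lemma wp13_reflect:
  assumes "0 < i" "i < 13"
  shows "wp13 q (13 - i) = wp13 q i"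
  using zeta_series_reflect[OF power13_bounds(1,2), of "q ^ i"] wp_series_reflect[OF power13_bounds(1,2), of "q ^ i"]
    power13_bounds(3,4)[of i] reflect13[of i] assms
  by (auto simp: wp13_def power2_diff)

lemma zeta13_addition:
  assumes "0 < i" "0 < j" "0 < k" "i + j + k = 13"
  shows "(zeta13 q i + zeta13 q j + zeta13 q k)\<^sup>2 = wp13 q i + wp13 q j + wp13 q k - 1 / 2"
proof -
  let ?z = "\<lambda>i. zeta_series (q ^ 13) (q ^ i)" and ?p = "\<lambda>i. wp_series (q ^ 13) (q ^ i)"
  have "?z i * ?z j - ?z i * ?z (i + j) - ?z j * ?z (i + j) = ?p i + ?p j + ?p (i + j) - 1 / 4"
    using zeta_series_addition[OF power13_bounds(1,2), of "q ^ i" "q ^ j"]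
      power13_bounds(3)[of i] power13_bounds(3)[of j] power13_bounds(4)[of "i + j"] assms
    by (simp add: power_add)
  moreover have "(?z i + ?z j - ?z (i + j))\<^sup>2 = (?z i)\<^sup>2 + (?z j)\<^sup>2 + (?z (i + j))\<^sup>2
      + 2 * (?z i * ?z j - ?z i * ?z (i + j) - ?z j * ?z (i + j))"
    by (simp add: power2_eq_square algebra_simps)
  ultimately have "(?z i + ?z j - ?z (i + j))\<^sup>2 = wp13 q i + wp13 q j + wp13 q (i + j) - 1 / 2"
    by (simp add: wp13_def)
  \<comment> \<open>Reflection turns the minus sign at i + j into a plus sign at k; the linear
    corrections drop out because i + j - (i + j) = 0.\<close>
  moreover have "13 - k = i + j" using assms by simp
  then have "zeta13 q k = - zeta13 q (i + j)" "wp13 q k = wp13 q (i + j)"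
    using zeta13_reflect[of k] wp13_reflect[of k] assms by auto
  moreover have "?z i + ?z j - ?z (i + j) = zeta13 q i + zeta13 q j - zeta13 q (i + j)"
    by (simp add: zeta13_def add_divide_distrib)
  ultimately show ?thesis by simp
qed

end

section \<open>Inverting L(0,chi) and averaging over the odd characters\<close>

text \<open>The first factor is 2 / L(0,chi) reduced modulo w^6 + 1. The indices 1, 2, 4, 8, 3, 6
  are the powers 2^0, ..., 2^5 modulo 13, one from each pair {i, 13 - i}.\<close>

lemma E1_char_char13:
  assumes q: "q = nome \<tau>" and \<tau>: "Im \<tau> > 0" and w: "w ^ 6 = -1"
  shows "E1_char (char13 w) \<tau> = (1 - w ^ 2 + w ^ 3 - w ^ 4) *
    (zeta13 q 1 + w * zeta13 q 2 + w ^ 2 * zeta13 q 4 + w ^ 3 * zeta13 q 8 + w ^ 4 * zeta13 q 3 + w ^ 5 * zeta13 q 6)"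
proof -
  have q': "q \<noteq> 0" "norm q < 1"
    using \<tau> by (simp_all add: q nome_def)
  have char_values: "char13 w 1 = 1" "char13 w 2 = w" "char13 w 3 = w ^ 4" "char13 w 4 = w ^ 2"
    "char13 w 5 = - (w ^ 3)" "char13 w 6 = w ^ 5" "char13 w 7 = - (w ^ 5)" "char13 w 8 = w ^ 3"
    "char13 w 9 = - (w ^ 2)" "char13 w 10 = - (w ^ 4)" "char13 w 11 = - w" "char13 w 12 = -1" "char13 w 13 = 0"
    using w power_add[of w 6 1] power_add[of w 6 2] power_add[of w 6 3] power_add[of w 6 4] power_add[of w 6 5]
    by (simp_all add: char13_def dlog13_def)
  have per: "char13 w (n + int 13) = char13 w n" for n
    by (simp add: char13_def dlog13_def)
  have sum13: "(\<Sum>a=1..13. f a) = f 1 + f 2 + f 3 + f 4 + f 5 + f 6 + f 7 + f 8 + f 9 + f 10 + f 11 + f 12 + f 13"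
    for f :: "nat \<Rightarrow> complex"
    by (simp add: numeral_eq_Suc sum.atLeast1_atMost_eq algebra_simps)
  have norm_w: "norm w = 1"
  proof -
    have "norm w ^ 6 = 1" using w by (metis norm_minus_cancel norm_one norm_power)
    then show ?thesis using power_eq_1_iff[of "norm w" 6] by simp
  qed
  have bound: "norm (char13 w n) \<le> 1" for n
    by (simp add: char13_def norm_power norm_w)
  define L where "L = dirichlet_L (char13 w) 0"
  have "L = - (\<Sum>k=1..13. of_nat k * char13 w (int k)) / of_nat 13"
    unfolding L_def
  proof (rule dirichlet_L_0[of 13 "char13 w", OF _ per])
    show "(\<Sum>k=1..13. char13 w (int k)) = 0" unfolding sum13 by (simp add: char_values)
  qed simp
  then have L: "13 * L = 11 + 9 * w + 5 * w ^ 2 - 3 * w ^ 3 + 7 * w ^ 4 + w ^ 5"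
    unfolding sum13 by (simp add: char_values algebra_simps)
  have inverse: "(1 - w ^ 2 + w ^ 3 - w ^ 4) * (13 * L) = 26"
  proof -
    \<comment> \<open>The cofactor on the right is the quotient by w^6 + 1, so the identity holds
      for every w.\<close>
    have "(1 - w ^ 2 + w ^ 3 - w ^ 4) * (11 + 9 * w + 5 * w ^ 2 - 3 * w ^ 3 + 7 * w ^ 4 + w ^ 5) - 26 =
      (w ^ 6 + 1) * (- 15 + 9 * w - 6 * w ^ 2 - w ^ 3)"
      by algebra
    then show ?thesis using L w by simp
  qed
  \<comment> \<open>The explicit inverse also yields the nonvanishing of L(0,chi), by which
    \<open>E1_char\<close> divides.\<close>
  then have "L \<noteq> 0" by auto
  let ?\<Lambda> = "\<lambda>a. lambert (q ^ 13) (q ^ a)"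
  have zeta: "zeta13 q i = 1 / 2 + ?\<Lambda> i - ?\<Lambda> (13 - i) - of_nat i / 13" if "0 < i" "i < 13" for i
    using zeta_series_eq_lambert[OF power13_bounds(1,2)[OF q'], of "q ^ i"] power13_bounds(3,4)[OF q', of i]
      reflect13[OF q', of i] that
    by (simp add: zeta13_def)
  let ?S = "\<Sum>n. char13 w (int (Suc n)) * (q ^ Suc n / (1 - q ^ Suc n))"
  have S: "?S = (\<Sum>a=1..13. char13 w (int a) * ?\<Lambda> a)"
    by (rule periodic_lambert_eq[of 13 "char13 w" 1, OF _ per bound q']) simp
  \<comment> \<open>As chi(13 - i) = - chi(i), the Lambert series of i and 13 - i combine as in
    s(i), and the remaining parts 26 chi(i) (1/2 - i/13) sum to 13 L.\<close>
  have "26 * ?S + 13 * L = 26 * (zeta13 q 1 + w * zeta13 q 2 + w ^ 2 * zeta13 q 4 + w ^ 3 * zeta13 q 8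
      + w ^ 4 * zeta13 q 3 + w ^ 5 * zeta13 q 6)"
    unfolding S sum13 L by (simp add: char_values zeta algebra_simps)
  moreover have "13 * L * E1_char (char13 w) \<tau> = 13 * L + 26 * ?S"
    using \<open>L \<noteq> 0\<close> by (simp add: E1_char_def q L_def[symmetric] field_simps)
  ultimately have "(1 - w ^ 2 + w ^ 3 - w ^ 4) * (13 * L) * E1_char (char13 w) \<tau> = (1 - w ^ 2 + w ^ 3 - w ^ 4) *
      (26 * (zeta13 q 1 + w * zeta13 q 2 + w ^ 2 * zeta13 q 4 + w ^ 3 * zeta13 q 8
      + w ^ 4 * zeta13 q 3 + w ^ 5 * zeta13 q 6))"
    by (simp add: mult.assoc add.commute)
  then show ?thesis unfolding inverse mult.left_commute[of _ 26] by simp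
qed

text \<open>\<open>\<mu> j\<close> is the mean of w^j over the six roots, so averaging extracts the
  constant coefficient modulo w^6 + 1. chi(a) = w^k shifts exponents, and each of the four monomials
  of 2 / L(0,chi) meets exactly one of the six s(i): four of the \<open>\<nu> j\<close> with j < 6
  are +-1, the others 0.\<close>

lemma E13_eq:
  assumes q: "q = nome \<tau>" and \<tau>: "Im \<tau> > 0" and a: "\<not> 13 dvd a" and k: "k = dlog13 a"
  defines "\<mu> \<equiv> \<lambda>j. (if 6 dvd j then (-1) ^ (j div 6) else 0 :: complex)"
  defines "\<nu> \<equiv> \<lambda>j. \<mu> (k + j) - \<mu> (k + j + 2) + \<mu> (k + j + 3) - \<mu> (k + j + 4)"
  shows "E13 a \<tau> = \<nu> 0 * zeta13 q 1 + \<nu> 1 * zeta13 q 2 + \<nu> 2 * zeta13 q 4 + \<nu> 3 * zeta13 q 8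
    + \<nu> 4 * zeta13 q 3 + \<nu> 5 * zeta13 q 6"
proof -
  have \<mu>: "(\<Sum>w | w ^ 6 = (-1 :: complex). w ^ j) = 6 * \<mu> j" for j
    unfolding sum_power_roots \<mu>_def by simp
  let ?R = "{w :: complex. w ^ 6 = -1}"
  let ?t = "\<lambda>j w. w ^ (k + j) - w ^ (k + j + 2) + w ^ (k + j + 3) - w ^ (k + j + 4)"
  have \<nu>: "(\<Sum>w\<in>?R. ?t j w * c) = 6 * \<nu> j * c" for j and c :: complex
    unfolding \<nu>_def sum_distrib_right[symmetric] sum.distrib sum_subtractf \<mu> by (simp add: algebra_simps)
  have "E13 a \<tau> = 1 / 6 * (\<Sum>w\<in>?R. char13 w a * E1_char (char13 w) \<tau>)"
    unfolding E13_def using sum.reindex_bij_betw[OF bij_betw_char13, of "\<lambda>chi. chi a * E1_char chi \<tau>"] by simp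
  also have "(\<Sum>w\<in>?R. char13 w a * E1_char (char13 w) \<tau>) = (\<Sum>w\<in>?R. ?t 0 w * zeta13 q 1
      + ?t 1 w * zeta13 q 2 + ?t 2 w * zeta13 q 4 + ?t 3 w * zeta13 q 8 + ?t 4 w * zeta13 q 3 + ?t 5 w * zeta13 q 6)"
  proof (rule sum.cong[OF refl])
    fix w :: complex assume "w \<in> ?R"
    then have eq: "char13 w a * E1_char (char13 w) \<tau> = w ^ k * ((1 - w ^ 2 + w ^ 3 - w ^ 4) *
      (zeta13 q 1 + w * zeta13 q 2 + w ^ 2 * zeta13 q 4 + w ^ 3 * zeta13 q 8 + w ^ 4 * zeta13 q 3 + w ^ 5 * zeta13 q 6))"
      using E1_char_char13[OF q \<tau>, of w] a k by (simp add: char13_def)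
    show "char13 w a * E1_char (char13 w) \<tau> = ?t 0 w * zeta13 q 1
      + ?t 1 w * zeta13 q 2 + ?t 2 w * zeta13 q 4 + ?t 3 w * zeta13 q 8 + ?t 4 w * zeta13 q 3 + ?t 5 w * zeta13 q 6"
      unfolding eq power_add by (simp add: eval_nat_numeral algebra_simps)
  qed
  also have "\<dots> = 6 * (\<nu> 0 * zeta13 q 1 + \<nu> 1 * zeta13 q 2 + \<nu> 2 * zeta13 q 4 + \<nu> 3 * zeta13 q 8
    + \<nu> 4 * zeta13 q 3 + \<nu> 5 * zeta13 q 6)"
    unfolding sum.distrib \<nu> by (simp add: algebra_simps)
  finally show ?thesis unfolding mult.assoc[symmetric] by simp
qed

theorem theorem5p3:
  fixes \<tau> :: complex
  assumes "Im \<tau> > 0"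
  shows "let E = (\<lambda>a::int. E13 a \<tau>) in
         E 1 * E 3 + E 2 * E 3 - E 1 * E 5 - E 1 * E 7 - E 2 * E 7 - E 5 * E 7 = 0
       \<and> E 1 * E 4 - E 1 * E 5 + E 3 * E 7 + E 4 * E 7 - E 5 * E 7 = 0
       \<and> E 3 * E 5 - E 1 * E 7 - E 3 * E 7 = 0"
proof -
  define q where "q = nome \<tau>"
  have q: "q \<noteq> 0" "norm q < 1"
    using assms by (simp_all add: q_def nome_def)
  let ?s = "zeta13 q" and ?P = "wp13 q"
  have s8: "?s 8 = - ?s 5" "?s 9 = - ?s 4" "?s 10 = - ?s 3" "?s 11 = - ?s 2" "?s 7 = - ?s 6"
    using zeta13_reflect[OF q, of 5] zeta13_reflect[OF q, of 4] zeta13_reflect[OF q, of 3]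
      zeta13_reflect[OF q, of 2] zeta13_reflect[OF q, of 6] by simp_all
  have P8: "?P 8 = ?P 5" "?P 9 = ?P 4" "?P 10 = ?P 3" "?P 11 = ?P 2" "?P 7 = ?P 6"
    using wp13_reflect[OF q, of 5] wp13_reflect[OF q, of 4] wp13_reflect[OF q, of 3]
      wp13_reflect[OF q, of 2] wp13_reflect[OF q, of 6] by simp_all
  note E = E13_eq[OF q_def assms]
  have E1: "E13 1 \<tau> = ?s 1 + ?s 3 + ?s 4 + ?s 5"
    by (subst E[of 1 0]) (simp_all add: dlog13_def s8 flip: One_nat_def)
  have E2: "E13 2 \<tau> = ?s 2 - ?s 4 - ?s 5 - ?s 6"
    by (subst E[of 2 1]) (simp_all add: dlog13_def s8 flip: One_nat_def)
  have E3: "E13 3 \<tau> = ?s 1 - ?s 3 - ?s 4 + ?s 6"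
    by (subst E[of 3 4]) (simp_all add: dlog13_def s8 flip: One_nat_def)
  have E4: "E13 4 \<tau> = ?s 1 - ?s 2 - ?s 3 + ?s 4"
    by (subst E[of 4 2]) (simp_all add: dlog13_def s8 flip: One_nat_def)
  have E5: "E13 5 \<tau> = ?s 1 - ?s 2 - ?s 5 + ?s 6"
    by (subst E[of 5 9]) (simp_all add: dlog13_def s8 flip: One_nat_def)
  have E7: "E13 7 \<tau> = ?s 2 - ?s 3 - ?s 5 + ?s 6"
    by (subst E[of 7 11]) (simp_all add: dlog13_def s8 flip: One_nat_def)
  have rel: "(?s i + ?s j + ?s k)\<^sup>2 - (?P i + ?P j + ?P k - 1 / 2) = 0"
    if "0 < i" "0 < j" "0 < k" "i + j + k = 13" for i j k
    using zeta13_addition[OF q that] by simp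
  show ?thesis
    unfolding Let_def E1 E2 E3 E4 E5 E7
  proof (intro conjI)
    let ?E1 = "?s 1 + ?s 3 + ?s 4 + ?s 5" and ?E2 = "?s 2 - ?s 4 - ?s 5 - ?s 6"
    let ?E3 = "?s 1 - ?s 3 - ?s 4 + ?s 6" and ?E4 = "?s 1 - ?s 2 - ?s 3 + ?s 4"
    let ?E5 = "?s 1 - ?s 2 - ?s 5 + ?s 6" and ?E7 = "?s 2 - ?s 3 - ?s 5 + ?s 6"
    let ?r = "\<lambda>i j k. (?s i + ?s j + ?s k)\<^sup>2 - (?P i + ?P j + ?P k - 1 / 2)"
    have zero: "?r 1 3 9 = 0" "?r 1 4 8 = 0" "?r 1 5 7 = 0" "?r 1 6 6 = 0" "?r 2 3 8 = 0" "?r 2 5 6 = 0"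
      "?r 1 2 10 = 0" "?r 3 3 7 = 0" "?r 3 4 6 = 0" "?r 4 4 5 = 0" "?r 1 1 11 = 0" "?r 2 4 7 = 0" "?r 3 5 5 = 0"
      by (rule rel; simp)+
    \<comment> \<open>After reflection to indices 1 to 6 each \<open>?P i\<close> occurs equally
      often with either sign (twice in \<open>?r 1 6 6\<close>), so only squares remain and the
      claim is a polynomial identity in six variables. The two later combinations are balanced in
      the same way.\<close>
    have "?E1 * ?E3 + ?E2 * ?E3 - ?E1 * ?E5 - ?E1 * ?E7 - ?E2 * ?E7 - ?E5 * ?E7
        = (?r 1 3 9 - ?r 1 4 8 + ?r 1 5 7 - ?r 1 6 6 - ?r 2 3 8 + ?r 2 5 6) / 2"
      unfolding s8 P8 by (simp add: power2_eq_square field_simps)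
    then show "?E1 * ?E3 + ?E2 * ?E3 - ?E1 * ?E5 - ?E1 * ?E7 - ?E2 * ?E7 - ?E5 * ?E7 = 0"
      by (simp only: zero) simp
    have "?E1 * ?E4 - ?E1 * ?E5 + ?E3 * ?E7 + ?E4 * ?E7 - ?E5 * ?E7
        = (?r 1 2 10 - ?r 1 3 9 - ?r 2 3 8 + ?r 3 3 7 - ?r 3 4 6 + ?r 4 4 5) / 2"
      unfolding s8 P8 by (simp add: power2_eq_square field_simps)
    then show "?E1 * ?E4 - ?E1 * ?E5 + ?E3 * ?E7 + ?E4 * ?E7 - ?E5 * ?E7 = 0"
      by (simp only: zero) simp
    have "?E3 * ?E5 - ?E1 * ?E7 - ?E3 * ?E7
        = (?r 1 1 11 - ?r 1 2 10 - ?r 1 4 8 + ?r 2 4 7 - ?r 2 5 6 + ?r 3 5 5) / 2"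
      unfolding s8 P8 by (simp add: power2_eq_square field_simps)
    then show "?E3 * ?E5 - ?E1 * ?E7 - ?E3 * ?E7 = 0"
      by (simp only: zero) simp
  qed
qed

end
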